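(* Let $B$ be a Martin-Löf random planar path started at $(0,0)$. Then for every time $t>0$ such that $B(t)\neq(0,0)$, the path $B$ is not Martin-Löf random relative to the point $B(t)=(B_x(t),B_y(t))$.
   Context: A planar path is an element $B=(B_x,B_y)$ of $C([0,\infty),\mathbb{R}^2)$; the space is equipped with two-dimensional Wiener measure (the law of $(\mathscr{B}_1,\mathscr{B}_2)$ with $\mathscr{B}_1,\mathscr{B}_2$ independent standard one-dimensional Brownian motions started at $0$), a computable probability space. $B$ is Martin-Löf random if it is Martin-Löf random for this measure (equivalently, $B_x$ and $B_y$ are mutually Martin-Löf random one-dimensional Brownian paths). Randomness relative to a point means relative to an oracle for (a name of) that point. *)

theory Defs
  imports "HOL-Probability.Probability" "HOL-Library.Nat_Bijection"
begin

section \<open>Partial recursive functions with an oracle\<close>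

datatype precfn =
    Zero
  | Succ
  | Proj nat
  | Query
  | Comp precfn "precfn list"
  | PrimRec precfn precfn
  | Mu precfn

text \<open>\<open>computes p r xs y\<close> means that the program \<open>r\<close>, with the function \<open>p\<close> as its oracle, halts
  on the argument tuple \<open>xs\<close> with output \<open>y\<close>.\<close>

inductive computes :: "(nat \<Rightarrow> nat) \<Rightarrow> precfn \<Rightarrow> nat list \<Rightarrow> nat \<Rightarrow> bool" for p :: "nat \<Rightarrow> nat" where
  "computes p Zero xs 0"
| "computes p Succ (x # xs) (Suc x)"
| "i < length xs \<Longrightarrow> computes p (Proj i) xs (xs ! i)"
| "computes p Query (x # xs) (p x)"
| "list_all2 (\<lambda>g y. computes p g xs y) gs ys \<Longrightarrow> computes p f ys z
    \<Longrightarrow> computes p (Comp f gs) xs z"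
| "computes p f xs y \<Longrightarrow> computes p (PrimRec f g) (0 # xs) y"
| "computes p (PrimRec f g) (n # xs) y \<Longrightarrow> computes p g (n # y # xs) z
    \<Longrightarrow> computes p (PrimRec f g) (Suc n # xs) z"
| "computes p f (n # xs) 0 \<Longrightarrow> \<forall>i<n. \<exists>y. computes p f (i # xs) (Suc y)
    \<Longrightarrow> computes p (Mu f) xs n"

definition ce_relative :: "(nat \<Rightarrow> nat) \<Rightarrow> nat set \<Rightarrow> bool" where
  "ce_relative p A \<longleftrightarrow> (\<exists>r. A = {x. \<exists>y. computes p r [x] y})"


section \<open>Rational points of the plane and names\<close>

definition rat_of_code :: "nat \<Rightarrow> real" where
  "rat_of_code c = (case prod_decode c of (a, b) \<Rightarrow> real_of_int (int_decode a) / real (Suc b))"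

definition ratpoint_of_code :: "nat \<Rightarrow> real \<times> real" where
  "ratpoint_of_code c = (case prod_decode c of (a, b) \<Rightarrow> (rat_of_code a, rat_of_code b))"

definition is_name :: "(nat \<Rightarrow> nat) \<Rightarrow> real \<times> real \<Rightarrow> bool" where
  "is_name p z \<longleftrightarrow> (\<forall>n. dist (ratpoint_of_code (p n)) z \<le> (1 / 2) ^ n)"


section \<open>The computable metric space of planar paths\<close>

text \<open>Paths are only defined on \<open>{0..}\<close>; \<open>extensional\<close> fixes their values at negative times, so that
  equality of elements of \<open>path_space\<close> is equality of paths.\<close>

type_synonym planar_path = "real \<Rightarrow> real \<times> real"

definition path_space :: "planar_path set" where
  "path_space = {B \<in> extensional {0..}. continuous_on {0..} B}"

text \<open>A metric for locally uniform convergence.\<close>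

definition path_dist :: "planar_path \<Rightarrow> planar_path \<Rightarrow> real" where
  "path_dist f g =
     (\<Sum>n. (1 / 2) ^ Suc n * (SUP t\<in>{0..real (Suc n)}. min 1 (dist (f t) (g t))))"

lemma bdd_above_min_dist: "bdd_above ((\<lambda>t. min 1 (dist (f t) (g t))) ` A)"
  for f g :: planar_path
  by (rule bdd_aboveI2[of _ _ 1]) simp

lemma SUP_min_dist_upper:
  fixes f g :: planar_path
  assumes "0 \<le> t" "t \<le> T"
  shows "min 1 (dist (f t) (g t)) \<le> (SUP t\<in>{0..T}. min 1 (dist (f t) (g t)))"
  using assms by (intro cSUP_upper bdd_above_min_dist) auto

lemma SUP_min_dist_bounds:
  fixes f g :: planar_path
  assumes "0 \<le> T"
  shows "0 \<le> (SUP t\<in>{0..T}. min 1 (dist (f t) (g t)))"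
    and "(SUP t\<in>{0..T}. min 1 (dist (f t) (g t))) \<le> 1"
proof -
  show "0 \<le> (SUP t\<in>{0..T}. min 1 (dist (f t) (g t)))"
    using assms by (intro order_trans[OF _ SUP_min_dist_upper[of 0]]) auto
  show "(SUP t\<in>{0..T}. min 1 (dist (f t) (g t))) \<le> 1"
    using assms by (intro cSUP_least) auto
qed

lemma path_dist_summable:
  "summable (\<lambda>n. (1 / 2) ^ Suc n * (SUP t\<in>{0..real (Suc n)}. min 1 (dist (f t) (g t))))"
  for f g :: planar_path
proof (rule summable_comparison_test')
  show "summable (\<lambda>n. (1 / 2 :: real) ^ Suc n)"
    by (subst summable_Suc_iff) (rule summable_geometric, simp)
  show "norm ((1 / 2) ^ Suc n * (SUP t\<in>{0..real (Suc n)}. min 1 (dist (f t) (g t))))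
      \<le> (1 / 2) ^ Suc n" for n
    using SUP_min_dist_bounds[of "real (Suc n)" f g]
    by (simp add: abs_mult mult_left_le)
qed

lemma Metric_space_path: "Metric_space path_space path_dist"
proof
  fix f g h :: planar_path
  show "path_dist f g = path_dist g f"
    by (simp add: path_dist_def dist_commute)
  show "0 \<le> path_dist f g"
    unfolding path_dist_def
    by (intro suminf_nonneg path_dist_summable mult_nonneg_nonneg SUP_min_dist_bounds) auto
  show "path_dist f h \<le> path_dist f g + path_dist g h"
  proof -
    have "(SUP t\<in>{0..T}. min 1 (dist (f t) (h t)))
        \<le> (SUP t\<in>{0..T}. min 1 (dist (f t) (g t))) + (SUP t\<in>{0..T}. min 1 (dist (g t) (h t)))"
      if "0 \<le> T" for T
    proof (rule cSUP_least)
      fix t assume t: "t \<in> {0..T}"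
      have "min 1 (dist (f t) (h t)) \<le> min 1 (dist (f t) (g t)) + min 1 (dist (g t) (h t))"
        using dist_triangle[of "f t" "h t" "g t"] zero_le_dist[of "f t" "g t"]
          zero_le_dist[of "g t" "h t"] by linarith
      then show "min 1 (dist (f t) (h t))
        \<le> (SUP t\<in>{0..T}. min 1 (dist (f t) (g t))) + (SUP t\<in>{0..T}. min 1 (dist (g t) (h t)))"
        using SUP_min_dist_upper[of t T f g] SUP_min_dist_upper[of t T g h] t by simp
    qed (use that in auto)
    then have *: "(1 / 2) ^ Suc n * (SUP t\<in>{0..real (Suc n)}. min 1 (dist (f t) (h t)))
        \<le> (1 / 2) ^ Suc n * (SUP t\<in>{0..real (Suc n)}. min 1 (dist (f t) (g t)))
          + (1 / 2) ^ Suc n * (SUP t\<in>{0..real (Suc n)}. min 1 (dist (g t) (h t)))" for n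
      by (subst distrib_left[symmetric], intro mult_left_mono) auto
    show ?thesis
      unfolding path_dist_def
      by (subst suminf_add[OF path_dist_summable path_dist_summable])
        (intro suminf_le * path_dist_summable summable_add)
  qed
  show "path_dist f g = 0 \<longleftrightarrow> f = g" if f: "f \<in> path_space" and g: "g \<in> path_space"
  proof
    assume "path_dist f g = 0"
    then have 0: "(1 / 2) ^ Suc n * (SUP t\<in>{0..real (Suc n)}. min 1 (dist (f t) (g t))) = 0" for n
      unfolding path_dist_def
      by (subst (asm) suminf_eq_zero_iff[OF path_dist_summable])
        (intro mult_nonneg_nonneg SUP_min_dist_bounds, auto)
    have "f t = g t" if "0 \<le> t" for t
    proof -
      have "t \<le> real (Suc (nat \<lceil>t\<rceil>))" by linarith
      from SUP_min_dist_upper[OF that this, of f g] 0[of "nat \<lceil>t\<rceil>"] show ?thesis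
        by (auto simp: min_def split: if_splits)
    qed
    then show "f = g"
      using f g by (auto simp: path_space_def intro: extensionalityI[of f "{0..}" g])
  next
    assume "f = g"
    then show "path_dist f g = 0" by (simp add: path_dist_def)
  qed
qed

text \<open>The ideal points are the piecewise linear paths with finitely many breakpoints, all of them
  rational with rational values, that eventually vanish. Here they are written as sums of hat
  functions: \<open>polygonal_path m cs\<close> interpolates linearly between the values
  \<open>ratpoint_of_code (cs ! k)\<close> at the times \<open>k / (m + 1)\<close> for \<open>k < length cs\<close>, and \<open>0\<close> at all later
  multiples of \<open>1 / (m + 1)\<close>.\<close>

definition polygonal_path :: "nat \<Rightarrow> nat list \<Rightarrow> planar_path" where
  "polygonal_path m cs = (\<lambda>t\<in>{0..}.
     \<Sum>k<length cs. max 0 (1 - \<bar>real (Suc m) * t - real k\<bar>) *\<^sub>R ratpoint_of_code (cs ! k))"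

definition ideal_path :: "nat \<Rightarrow> planar_path" where
  "ideal_path i = (case prod_decode i of (m, c) \<Rightarrow> polygonal_path m (list_decode c))"

definition ideal_ball :: "nat \<Rightarrow> planar_path set" where
  "ideal_ball k = (case prod_decode k of (i, q) \<Rightarrow>
     Metric_space.mball path_space path_dist (ideal_path i) (rat_of_code q))"

lemma ideal_path_in_path_space: "ideal_path i \<in> path_space"
proof -
  have "continuous_on {0..} (polygonal_path m cs)" for m cs
  proof (rule continuous_on_eq)
    show "continuous_on {0..} (\<lambda>t. \<Sum>k<length cs.
        max 0 (1 - \<bar>real (Suc m) * t - real k\<bar>) *\<^sub>R ratpoint_of_code (cs ! k))"
      by (intro continuous_intros)
  qed (simp add: polygonal_path_def)
  then show ?thesis
    by (auto simp: ideal_path_def path_space_def polygonal_path_def split: prod.split)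
qed


section \<open>Planar Wiener measure\<close>

definition path_borel :: "planar_path measure" where
  "path_borel =
     sigma path_space {U. openin (Metric_space.mtopology path_space path_dist) U}"

definition standard_brownian_motion :: "'w measure \<Rightarrow> (real \<Rightarrow> 'w \<Rightarrow> real) \<Rightarrow> bool" where
  "standard_brownian_motion M X \<longleftrightarrow>
     prob_space M \<and>
     (\<forall>t\<ge>0. X t \<in> borel_measurable M) \<and>
     (AE \<omega> in M. X 0 \<omega> = 0) \<and>
     (\<forall>s t. 0 \<le> s \<longrightarrow> s < t \<longrightarrow>
        distributed M lborel (\<lambda>\<omega>. X t \<omega> - X s \<omega>) (normal_density 0 (sqrt (t - s)))) \<and>
     (\<forall>n (t :: nat \<Rightarrow> real). 0 \<le> t 0 \<longrightarrow> (\<forall>i<n. t i < t (Suc i)) \<longrightarrow>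
        prob_space.indep_vars M (\<lambda>_. borel) (\<lambda>i \<omega>. X (t (Suc i)) \<omega> - X (t i) \<omega>) {..<n}) \<and>
     (\<forall>\<omega>\<in>space M. continuous_on {0..} (\<lambda>t. X t \<omega>))"

text \<open>A Borel measure on the path space is the law of a pair of independent standard Brownian motions
  iff its two coordinate processes are independent standard Brownian motions. Independence of the
  processes is independence of the random elements of the product space indexed by all times. By
  Wiener's theorem there is exactly one such measure.\<close>

definition planar_wiener_measure :: "planar_path measure \<Rightarrow> bool" where
  "planar_wiener_measure W \<longleftrightarrow>
     space W = path_space \<and> sets W = sets path_borel \<and>
     standard_brownian_motion W (\<lambda>t B. fst (B t)) \<and>
     standard_brownian_motion W (\<lambda>t B. snd (B t)) \<and>
     prob_space.indep_var W
       (Pi\<^sub>M {0..} (\<lambda>_. borel)) (\<lambda>B. \<lambda>t\<in>{0..}. fst (B t))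
       (Pi\<^sub>M {0..} (\<lambda>_. borel)) (\<lambda>B. \<lambda>t\<in>{0..}. snd (B t))"


section \<open>Martin-Loef randomness\<close>

definition uniformly_effectively_open ::
    "(nat \<Rightarrow> nat) \<Rightarrow> (nat \<Rightarrow> planar_path set) \<Rightarrow> bool" where
  "uniformly_effectively_open p U \<longleftrightarrow>
     (\<exists>A. ce_relative p A \<and> (\<forall>n. U n = (\<Union>k\<in>{k. prod_encode (n, k) \<in> A}. ideal_ball k)))"

definition ml_test ::
    "(nat \<Rightarrow> nat) \<Rightarrow> planar_path measure \<Rightarrow> (nat \<Rightarrow> planar_path set) \<Rightarrow> bool" where
  "ml_test p W U \<longleftrightarrow>
     uniformly_effectively_open p U \<and> (\<forall>n. measure W (U n) \<le> (1 / 2) ^ n)"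

definition ml_random_relative :: "(nat \<Rightarrow> nat) \<Rightarrow> planar_path measure \<Rightarrow> planar_path \<Rightarrow> bool" where
  "ml_random_relative p W B \<longleftrightarrow>
     B \<in> path_space \<and> (\<forall>U. ml_test p W U \<longrightarrow> B \<notin> (\<Inter>n. U n))"

definition ml_random :: "planar_path measure \<Rightarrow> planar_path \<Rightarrow> bool" where
  "ml_random W B \<longleftrightarrow> ml_random_relative (\<lambda>_. 0) W B"

text \<open>A name may carry information beyond the point it names (every oracle is computable from some
  name of a given point), so a path is random relative to a point when it is random relative to at
  least one name of it. Since the binary expansions of the coordinates yield a name that is
  computable from every other name, this is the same as randomness relative to that name. The
  negation says that no name of the point leaves the path random.\<close>

definition ml_random_relative_to_point ::
    "planar_path measure \<Rightarrow> planar_path \<Rightarrow> real \<times> real \<Rightarrow> bool" where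
  "ml_random_relative_to_point W B z \<longleftrightarrow> (\<exists>p. is_name p z \<and> ml_random_relative p W B)"

end

theory Submission
  imports Defs
begin

text \<open>
  Relative to a name of \<open>z = B t \<noteq> 0\<close>, the paths that come close to \<open>z\<close> before a fixed time form an
  effectively open set, so it suffices to bound its measure by an explicit null sequence. For a
  square of side of order \<open>r = 2 ^ - L\<close> about \<open>z\<close> one compares, on a grid of small mesh \<open>h\<close>, two
  estimates of the expected number of grid times at which the path is in the doubled square. Since
  \<open>z \<noteq> 0\<close>, it is at most of order \<open>r\<^sup>2 / h\<close>; since the increments after the first entrance are
  independent of the past, it is at least the probability of an entrance times
  \<open>\<Sum>k. r\<^sup>2 / (k * h)\<close> over \<open>r\<^sup>2 \<le> k * h < 1\<close>, which is of order \<open>L * r\<^sup>2 / h\<close>. So the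
  probability of an entrance is \<open>O (1 / L)\<close>, uniformly in \<open>h\<close>, and \<open>L = K * 2 ^ n\<close> with a suitable
  constant \<open>K\<close> yields a Martin-Loef test relative to the name that captures \<open>B\<close>.
\<close>

section \<open>Computable functions\<close>

text \<open>Rule induction on the first computation. For \<open>Mu\<close>, two different results
  are impossible because at the smaller one the program would have both the output 0 and a positive
  output.\<close>

lemma computes_deterministic:
  "computes p r xs y \<Longrightarrow> computes p r xs y' \<Longrightarrow> y = y'"
proof (induction arbitrary: y' rule: computes.induct)
  case (5 xs gs ys f z)
  from 5(4) obtain ys' where ys': "list_all2 (\<lambda>g y. computes p g xs y) gs ys'" "computes p f ys' y'"
    by (cases rule: computes.cases) auto
  have "ys = ys'"
    using 5(1) ys'(1) by (auto simp: list_all2_conv_all_nth intro: nth_equalityI)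
  with 5 ys'(2) show ?case by blast
next
  case (6 f xs y g)
  from 6(3) show ?case by (cases rule: computes.cases) (use 6(2) in auto)
next
  case (7 f g n xs y z)
  from 7(5) obtain w where "computes p (PrimRec f g) (n # xs) w" "computes p g (n # w # xs) y'"
    by (cases rule: computes.cases) auto
  with 7(3,4) show ?case by blast
next
  case (8 f n xs)
  from 8(4) have n': "computes p f (y' # xs) 0" "\<forall>i<y'. \<exists>y. computes p f (i # xs) (Suc y)"
    by (cases rule: computes.cases, auto)+
  show ?case
  proof (rule linorder_cases[of n y'])
    assume "n < y'"
    with n'(2) 8(2) show ?thesis by blast
  next
    assume "y' < n"
    with n'(1) 8(3) show ?thesis by blast
  qed
qed (erule computes.cases; simp; fail)+

text \<open>Terms with free variables are rendered as functions of the list of their values: a new variable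
  is consed to the front, so that \<open>hd\<close>, \<open>hd \<circ> tl\<close>, ... are the variables and \<open>tl\<close> is weakening.\<close>

definition total_computable :: "(nat \<Rightarrow> nat) \<Rightarrow> nat \<Rightarrow> (nat list \<Rightarrow> nat) \<Rightarrow> bool" where
  "total_computable p n f \<longleftrightarrow> (\<exists>r. \<forall>xs. length xs = n \<longrightarrow> computes p r xs (f xs))"

lemma total_computable_cong:
  assumes "\<And>xs. length xs = n \<Longrightarrow> f xs = g xs" "total_computable p n f"
  shows "total_computable p n g"
  using assms unfolding total_computable_def by metis

lemma total_computable_hd: "total_computable p (Suc n) hd"
  unfolding total_computable_def
proof (intro exI allI impI)
  fix xs :: "nat list" assume "length xs = Suc n"
  then show "computes p (Proj 0) xs (hd xs)"
    using computes.intros(3)[of 0 xs p] by (cases xs) auto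
qed

lemma total_computable_tl:
  assumes "total_computable p n f"
  shows "total_computable p (Suc n) (\<lambda>xs. f (tl xs))"
proof -
  obtain r where r: "\<And>xs. length xs = n \<Longrightarrow> computes p r xs (f xs)"
    using assms by (auto simp: total_computable_def)
  have "computes p (Comp r (map Proj [1..<Suc n])) xs (f (tl xs))" if "length xs = Suc n" for xs
  proof (rule computes.intros(5))
    show "list_all2 (\<lambda>g. computes p g xs) (map Proj [1..<Suc n]) (tl xs)"
      using that computes.intros(3)[of "Suc _" xs p]
      by (simp add: list_all2_conv_all_nth nth_tl del: upt_Suc)
    show "computes p r (tl xs) (f (tl xs))" using r that by simp
  qed
  then show ?thesis unfolding total_computable_def by blast
qed

text \<open>Substitution under the front-consing convention: the value of \<open>g\<close> becomes
  the newest variable. Closure rules for \<open>Suc\<close>, the oracle and primitive recursion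
  reduce through it to the case where the argument is \<open>hd\<close>.\<close>

lemma total_computable_let:
  assumes "total_computable p (Suc n) (\<lambda>ys. F (hd ys) (tl ys))" "total_computable p n g"
  shows "total_computable p n (\<lambda>xs. F (g xs) xs)"
proof -
  obtain r s where r: "\<And>ys. length ys = Suc n \<Longrightarrow> computes p r ys (F (hd ys) (tl ys))"
    and s: "\<And>xs. length xs = n \<Longrightarrow> computes p s xs (g xs)"
    using assms unfolding total_computable_def by metis
  have "computes p (Comp r (s # map Proj [0..<n])) xs (F (g xs) xs)" if "length xs = n" for xs
  proof (rule computes.intros(5)[where ys = "g xs # xs"])
    show "computes p r (g xs # xs) (F (g xs) xs)" using r[of "g xs # xs"] that by simp
    show "list_all2 (\<lambda>g. computes p g xs) (s # map Proj [0..<n]) (g xs # xs)"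
      using that s computes.intros(3)[of _ xs p]
      by (simp add: list_all2_conv_all_nth nth_Cons split: nat.split)
  qed
  then show ?thesis unfolding total_computable_def by blast
qed

lemma total_computable_Suc:
  assumes "total_computable p n f" shows "total_computable p n (\<lambda>xs. Suc (f xs))"
proof (rule total_computable_let[OF _ assms])
  show "total_computable p (Suc n) (\<lambda>ys. Suc (hd ys))"
    unfolding total_computable_def
  proof (intro exI allI impI)
    fix xs :: "nat list" assume "length xs = Suc n"
    then show "computes p Succ xs (Suc (hd xs))" by (cases xs) (auto intro: computes.intros(2))
  qed
qed

lemma total_computable_oracle:
  assumes "total_computable p n f" shows "total_computable p n (\<lambda>xs. p (f xs))"
proof (rule total_computable_let[OF _ assms])
  show "total_computable p (Suc n) (\<lambda>ys. p (hd ys))"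
    unfolding total_computable_def
  proof (intro exI allI impI)
    fix xs :: "nat list" assume "length xs = Suc n"
    then show "computes p Query xs (p (hd xs))" by (cases xs) (auto intro: computes.intros(4))
  qed
qed

lemma total_computable_const: "total_computable p n (\<lambda>xs. c)"
proof (induction c)
  case 0
  then show ?case unfolding total_computable_def by (metis computes.intros(1))
next
  case (Suc c)
  then show ?case by (rule total_computable_Suc)
qed

lemma total_computable_rec_nat:
  assumes "total_computable p n f"
    and "total_computable p (Suc (Suc n)) (\<lambda>ys. G (hd ys) (hd (tl ys)) (tl (tl ys)))"
    and "total_computable p n h"
  shows "total_computable p n (\<lambda>xs. rec_nat (f xs) (\<lambda>k y. G k y xs) (h xs))"
proof (rule total_computable_let[OF _ assms(3)])
  obtain r s where r: "\<And>xs. length xs = n \<Longrightarrow> computes p r xs (f xs)"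
    and s: "\<And>ys. length ys = Suc (Suc n) \<Longrightarrow> computes p s ys (G (hd ys) (hd (tl ys)) (tl (tl ys)))"
    using assms unfolding total_computable_def by metis
  have *: "computes p (PrimRec r s) (k # xs) (rec_nat (f xs) (\<lambda>k y. G k y xs) k)"
    if "length xs = n" for k xs
  proof (induction k)
    case 0
    show ?case using r[OF that] by (auto intro: computes.intros(6))
  next
    case (Suc k)
    show ?case
      by (rule computes.intros(7)[OF Suc]) (use s[of "k # _ # xs"] that in auto)
  qed
  show "total_computable p (Suc n) (\<lambda>ys. rec_nat (f (tl ys)) (\<lambda>k y. G k y (tl ys)) (hd ys))"
    unfolding total_computable_def
  proof (intro exI allI impI)
    fix ys :: "nat list" assume "length ys = Suc n"
    then show "computes p (PrimRec r s) ys (rec_nat (f (tl ys)) (\<lambda>k y. G k y (tl ys)) (hd ys))"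
      using * by (cases ys) auto
  qed
qed

section \<open>Arithmetic, bounded sums and pairing\<close>

lemma total_computable_add:
  assumes "total_computable p n f" "total_computable p n g"
  shows "total_computable p n (\<lambda>xs. f xs + g xs)"
proof (rule total_computable_cong)
  show "total_computable p n (\<lambda>xs. rec_nat (f xs) (\<lambda>k y. Suc y) (g xs))"
    by (intro total_computable_rec_nat total_computable_Suc total_computable_tl
        total_computable_hd assms)
  have "rec_nat a (\<lambda>k y. Suc y) m = a + m" for a m by (induction m) auto
  then show "rec_nat (f xs) (\<lambda>k y. Suc y) (g xs) = f xs + g xs" for xs .
qed

lemma rec_nat_add: "rec_nat 0 (\<lambda>k y. y + (f k :: nat)) n = (\<Sum>i<n. f i)"
  by (induction n) auto

text \<open>Weakening in the second position instead of the front. The body of a primitive recursion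
  sees the counter and the accumulated value, whereas a summand depends on the counter only.\<close>

lemma total_computable_skip:
  assumes "total_computable p (Suc n) (\<lambda>ys. F (hd ys) (tl ys))"
  shows "total_computable p (Suc (Suc n)) (\<lambda>ys. F (hd ys) (tl (tl ys)))"
proof -
  obtain r where r: "\<And>ys. length ys = Suc n \<Longrightarrow> computes p r ys (F (hd ys) (tl ys))"
    using assms unfolding total_computable_def by metis
  have "computes p (Comp r (Proj 0 # map Proj [2..<Suc (Suc n)])) ys (F (hd ys) (tl (tl ys)))"
    if ys: "length ys = Suc (Suc n)" for ys
  proof (rule computes.intros(5)[where ys = "hd ys # tl (tl ys)"])
    show "computes p r (hd ys # tl (tl ys)) (F (hd ys) (tl (tl ys)))"
      using r[of "hd ys # tl (tl ys)"] ys by simp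
    have "computes p (Proj 0) ys (hd ys)"
      using computes.intros(3)[of 0 ys p] ys by (cases ys) auto
    moreover have "list_all2 (\<lambda>g. computes p g ys) (map Proj [2..<Suc (Suc n)]) (tl (tl ys))"
      using ys computes.intros(3)[of "Suc (Suc _)" ys p]
      by (simp add: list_all2_conv_all_nth nth_tl del: upt_Suc)
    ultimately show "list_all2 (\<lambda>g. computes p g ys) (Proj 0 # map Proj [2..<Suc (Suc n)]) (hd ys # tl (tl ys))"
      by (simp del: upt_Suc)
  qed
  then show ?thesis unfolding total_computable_def by blast
qed

lemma total_computable_sum:
  assumes "total_computable p (Suc n) (\<lambda>ys. F (hd ys) (tl ys))" "total_computable p n g"
  shows "total_computable p n (\<lambda>xs. \<Sum>i<g xs. F i xs)"
proof (rule total_computable_cong)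
  show "total_computable p n (\<lambda>xs. rec_nat 0 (\<lambda>k y. y + F k xs) (g xs))"
    by (intro total_computable_rec_nat total_computable_add total_computable_tl
        total_computable_hd total_computable_const total_computable_skip assms)
qed (simp add: rec_nat_add)

lemma total_computable_mult:
  assumes "total_computable p n f" "total_computable p n g"
  shows "total_computable p n (\<lambda>xs. f xs * g xs)"
proof (rule total_computable_cong)
  show "total_computable p n (\<lambda>xs. \<Sum>i<g xs. f xs)"
    by (intro total_computable_sum total_computable_tl assms)
qed simp

lemma total_computable_diff:
  assumes "total_computable p n f" "total_computable p n g"
  shows "total_computable p n (\<lambda>xs. f xs - g xs)"
proof (rule total_computable_cong)
  have pred: "total_computable p n (\<lambda>xs. f xs - 1)" if "total_computable p n f" for f n
  proof (rule total_computable_cong)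
    show "total_computable p n (\<lambda>xs. rec_nat 0 (\<lambda>k y. k) (f xs))"
      by (intro total_computable_rec_nat total_computable_hd total_computable_const that)
    show "rec_nat 0 (\<lambda>k y. k) (f xs) = f xs - 1" for xs by (cases "f xs") auto
  qed
  show "total_computable p n (\<lambda>xs. rec_nat (f xs) (\<lambda>k y. y - 1) (g xs))"
    by (intro total_computable_rec_nat pred total_computable_tl total_computable_hd assms)
  have "rec_nat a (\<lambda>k y. y - 1) m = a - m" for a m :: nat by (induction m) auto
  then show "rec_nat (f xs) (\<lambda>k y. y - 1) (g xs) = f xs - g xs" for xs .
qed

lemma total_computable_power2:
  assumes "total_computable p n f"
  shows "total_computable p n (\<lambda>xs. 2 ^ f xs)"
proof (rule total_computable_cong)
  show "total_computable p n (\<lambda>xs. rec_nat 1 (\<lambda>k y. y + y) (f xs))"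
    by (intro total_computable_rec_nat total_computable_add total_computable_tl
        total_computable_hd total_computable_const assms)
  have "rec_nat 1 (\<lambda>k y. y + y) m = (2::nat) ^ m" for m by (induction m) auto
  then show "rec_nat 1 (\<lambda>k y. y + y) (f xs) = (2::nat) ^ f xs" for xs .
qed

lemma total_computable_eq:
  assumes "total_computable p n f" "total_computable p n g"
  shows "total_computable p n (\<lambda>xs. of_bool (f xs = g xs))"
proof (rule total_computable_cong)
  show "total_computable p n (\<lambda>xs. 1 - ((f xs - g xs) + (g xs - f xs)))"
    by (intro total_computable_diff total_computable_add total_computable_const assms)
qed auto

lemma total_computable_le:
  assumes "total_computable p n f" "total_computable p n g"
  shows "total_computable p n (\<lambda>xs. of_bool (f xs \<le> g xs))"
proof (rule total_computable_cong)
  show "total_computable p n (\<lambda>xs. 1 - (f xs - g xs))"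
    by (intro total_computable_diff total_computable_const assms)
qed auto

lemma total_computable_conj:
  assumes "total_computable p n (\<lambda>xs. of_bool (P xs))" "total_computable p n (\<lambda>xs. of_bool (Q xs))"
  shows "total_computable p n (\<lambda>xs. of_bool (P xs \<and> Q xs))"
  using total_computable_mult[OF assms] by (simp add: of_bool_conj)

text \<open>The Cantor pairing is a triangular number plus the first component, and a triangular
  number is a bounded sum.\<close>

lemma total_computable_prod_encode:
  assumes "total_computable p n f" "total_computable p n g"
  shows "total_computable p n (\<lambda>xs. prod_encode (f xs, g xs))"
proof (rule total_computable_cong)
  show "total_computable p n (\<lambda>xs. (\<Sum>i<Suc (f xs + g xs). i) + f xs)"
    by (intro total_computable_add total_computable_sum total_computable_hd total_computable_Suc
        assms)
  show "(\<Sum>i<Suc (f xs + g xs). i) + f xs = prod_encode (f xs, g xs)" for xs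
    by (simp add: prod_encode_def triangle_def gauss_sum_nat lessThan_Suc_atMost atMost_atLeast0)
qed

text \<open>Inverts the pairing by bounded search: both components of a pair are at most its code,
  so exactly one term of the double sum survives. This makes decoding computable from bounded sums
  and equality tests alone.\<close>

lemma prod_decode_eq_sums:
  fixes h :: "nat \<Rightarrow> nat \<Rightarrow> nat"
  shows "(\<Sum>a<Suc x. \<Sum>b<Suc x. h a b * of_bool (prod_encode (a, b) = x)) = case_prod h (prod_decode x)"
proof -
  obtain u v where uv: "prod_decode x = (u, v)" by fastforce
  then have x: "x = prod_encode (u, v)" by (metis prod_decode_inverse)
  have le: "u < Suc x" "v < Suc x"
    unfolding x using le_prod_encode_1 le_prod_encode_2 by (auto simp: less_Suc_eq_le)
  have "(\<Sum>a<Suc x. \<Sum>b<Suc x. h a b * of_bool (prod_encode (a, b) = x))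
      = (\<Sum>a<Suc x. \<Sum>b<Suc x. if a = u then if b = v then h u v else 0 else 0)"
    by (intro sum.cong refl) (auto simp: x prod_encode_eq)
  also have "\<dots> = (\<Sum>a<Suc x. if a = u then h u v else 0)"
    using le by (intro sum.cong refl) (simp add: if_distrib[where f = "\<lambda>w. sum w _"] sum.delta)
  also have "\<dots> = h u v" using le by (simp add: sum.delta)
  finally show ?thesis using uv by simp
qed

lemma total_computable_prod_decode:
  assumes "total_computable p n f"
  shows "total_computable p n (\<lambda>xs. fst (prod_decode (f xs)))"
    and "total_computable p n (\<lambda>xs. snd (prod_decode (f xs)))"
proof -
  have "total_computable p n (\<lambda>xs. \<Sum>a<Suc (f xs). \<Sum>b<Suc (f xs). a * of_bool (prod_encode (a, b) = f xs))"
    "total_computable p n (\<lambda>xs. \<Sum>a<Suc (f xs). \<Sum>b<Suc (f xs). b * of_bool (prod_encode (a, b) = f xs))"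
    by (intro total_computable_sum total_computable_mult total_computable_eq
        total_computable_prod_encode total_computable_tl total_computable_hd total_computable_Suc
        assms)+
  then show "total_computable p n (\<lambda>xs. fst (prod_decode (f xs)))"
    and "total_computable p n (\<lambda>xs. snd (prod_decode (f xs)))"
    by (simp_all only: prod_decode_eq_sums[where h = "\<lambda>a b. a"] prod_decode_eq_sums[where h = "\<lambda>a b. b"]
      fst_def snd_def)
qed

section \<open>Unbounded search and enumerability\<close>

text \<open>The set is the domain of a search for a witness \<open>j\<close>. Since
  \<open>Mu\<close> looks for a zero, it is applied to 1 minus the characteristic function of
  \<open>R\<close>.\<close>

lemma ce_relative_ex:
  assumes "total_computable p 2 (\<lambda>ys. of_bool (R (hd ys) (hd (tl ys))))"
  shows "ce_relative p {x. \<exists>j. R j x}"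
proof -
  have "total_computable p 2 (\<lambda>ys. 1 - of_bool (R (hd ys) (hd (tl ys))))"
    by (intro total_computable_diff total_computable_const assms)
  then obtain r where r: "\<And>ys. length ys = 2 \<Longrightarrow> computes p r ys (1 - of_bool (R (hd ys) (hd (tl ys))))"
    unfolding total_computable_def by blast
  have r': "computes p r [j, x] (of_bool (\<not> R j x))" for j x
    using r[of "[j, x]"] by (cases "R j x") auto
  have "(\<exists>y. computes p (Mu r) [x] y) \<longleftrightarrow> (\<exists>j. R j x)" for x
  proof
    assume "\<exists>y. computes p (Mu r) [x] y"
    then obtain y where "computes p (Mu r) [x] y" ..
    then have "computes p r [y, x] 0" by (cases rule: computes.cases) auto
    from computes_deterministic[OF this r'] have "R y x" by (cases "R y x") auto
    then show "\<exists>j. R j x" ..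
  next
    assume ex: "\<exists>j. R j x"
    have "computes p (Mu r) [x] (LEAST j. R j x)"
    proof (rule computes.intros(8))
      show "computes p r [LEAST j. R j x, x] 0" using r'[of "LEAST j. R j x" x] LeastI_ex[OF ex] by simp
      show "\<forall>i<LEAST j. R j x. \<exists>y. computes p r [i, x] (Suc y)"
      proof (intro allI impI exI)
        fix i assume "i < (LEAST j. R j x)"
        then have "\<not> R i x" by (rule not_less_Least)
        then show "computes p r [i, x] (Suc 0)" using r'[of i x] by simp
      qed
    qed
    then show "\<exists>y. computes p (Mu r) [x] y" ..
  qed
  then show ?thesis unfolding ce_relative_def by blast
qed

text \<open>A nonempty list is coded as the successor of the pair of head and coded tail, so one
  decrement and one projection remove the head. The code 0 of the empty list is a fixed point,
  because \<open>0 - 1 = 0\<close> and 0 decodes to \<open>(0, 0)\<close>.\<close>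

lemma list_tail_code:
  "rec_nat (list_encode cs) (\<lambda>k y. snd (prod_decode (y - 1))) j = list_encode (drop j cs)"
proof (induction j)
  case (Suc j)
  have 0: "prod_decode 0 = (0, 0)"
    using prod_encode_inverse[of "(0, 0)"] by (simp add: prod_encode_def)
  have "snd (prod_decode (list_encode xs - 1)) = list_encode (tl xs)" for xs
    using 0 by (cases xs) simp_all
  with Suc show ?case by (simp add: drop_Suc drop_tl)
qed simp

text \<open>The code being nonzero excludes positions past the end, where the decoded head would be
  the default 0.\<close>

lemma list_nth_code:
  "list_encode (drop j cs) \<noteq> 0 \<and> fst (prod_decode (list_encode (drop j cs) - 1)) = v
    \<longleftrightarrow> j < length cs \<and> cs ! j = v"
proof (cases "j < length cs")
  case True
  then show ?thesis using Cons_nth_drop_Suc[OF True, symmetric] by simp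
qed simp

text \<open>The polygonal path and the radius are decoded from the index itself, so only the
  breakpoint \<open>j\<close> has to be searched for. The bound \<open>j \<le> Suc m * T\<close>
  places its time \<open>j / (m + 1)\<close> before \<open>T\<close>.\<close>

lemma ce_relative_polygon_test:
  assumes "total_computable p 1 (\<lambda>xs. e (hd xs))" "total_computable p 1 (\<lambda>xs. v (hd xs))"
  shows "ce_relative p {prod_encode (n, prod_encode (prod_encode (m, list_encode cs), e n)) | n m cs.
    \<exists>j<length cs. j \<le> Suc m * T \<and> cs ! j = v n}"
proof -
  define R where "R j x \<longleftrightarrow> (let n = fst (prod_decode x); k = snd (prod_decode x);
      i = fst (prod_decode k); m = fst (prod_decode i);
      d = rec_nat (snd (prod_decode i)) (\<lambda>k y. snd (prod_decode (y - 1))) j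
    in snd (prod_decode k) = e n \<and> j \<le> Suc m * T \<and> 1 \<le> d \<and> fst (prod_decode (d - 1)) = v n)" for j x
  \<comment> \<open>The unary functions \<open>e\<close> and \<open>v\<close> are moved to an
    arbitrary list of variables: first to the newest variable, then by substitution to any
    computable argument.\<close>
  have ev: "total_computable p n (\<lambda>xs. e (f xs))" "total_computable p n (\<lambda>xs. v (f xs))"
    if f: "total_computable p n f" for n f
  proof -
    have "total_computable p (Suc n) (\<lambda>ys. g (hd ys))" if g: "total_computable p 1 (\<lambda>xs. g (hd xs))" for g
    proof -
      obtain r where r: "\<And>xs. length xs = 1 \<Longrightarrow> computes p r xs (g (hd xs))"
        using g unfolding total_computable_def by blast
      have "computes p (Comp r [Proj 0]) ys (g (hd ys))" if "length ys = Suc n" for ys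
        using that r[of "[hd ys]"] computes.intros(3)[of 0 ys p]
        by (intro computes.intros(5)[where ys = "[hd ys]"]) (auto, cases ys, auto)
      then show ?thesis unfolding total_computable_def by blast
    qed
    then show "total_computable p n (\<lambda>xs. e (f xs))" "total_computable p n (\<lambda>xs. v (f xs))"
      using f assms by (auto intro: total_computable_let)
  qed
  have "total_computable p 2 (\<lambda>ys. of_bool (R (hd ys) (hd (tl ys))))"
    unfolding R_def Let_def numeral_2_eq_2
    by (intro total_computable_conj total_computable_eq total_computable_le
        total_computable_mult total_computable_prod_decode total_computable_rec_nat
        total_computable_diff total_computable_tl total_computable_hd total_computable_Suc
        total_computable_const ev)
  then have "ce_relative p {x. \<exists>j. R j x}" by (rule ce_relative_ex)
  also have "{x. \<exists>j. R j x} = {prod_encode (n, prod_encode (prod_encode (m, list_encode cs), e n)) | n m cs.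
    \<exists>j<length cs. j \<le> Suc m * T \<and> cs ! j = v n}" (is "_ = ?S")
  proof (intro set_eqI)
    fix x
    obtain n m cs q where x: "x = prod_encode (n, prod_encode (prod_encode (m, list_encode cs), q))"
      by (metis list_decode_inverse prod_decode_inverse surj_pair)
    have "R j x \<longleftrightarrow> q = e n \<and> j \<le> Suc m * T \<and> j < length cs \<and> cs ! j = v n" for j
      unfolding R_def x using list_nth_code[of j cs "v n"]
      by (simp add: list_tail_code[simplified] Let_def Suc_le_eq)
    then show "x \<in> {x. \<exists>j. R j x} \<longleftrightarrow> x \<in> ?S"
      by (auto simp: x prod_encode_eq list_encode_eq)
  qed
  finally show ?thesis .
qed

section \<open>Approximation by polygonal paths\<close>

text \<open>The single term of index \<open>M\<close> in the series already controls the distance on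
  all of \<open>{0..M + 1}\<close>. As \<open>\<eta> \<le> 1\<close>, the truncation of distances at
  1 does no harm.\<close>

lemma dist_less_of_path_dist:
  assumes "0 \<le> s" "s \<le> real (Suc M)" "path_dist f g < (1 / 2) ^ Suc M * \<eta>" "\<eta> \<le> 1"
  shows "dist (f s) (g s) < \<eta>"
proof -
  have "(1 / 2) ^ Suc M * min 1 (dist (f s) (g s))
      \<le> (1 / 2) ^ Suc M * (SUP t\<in>{0..real (Suc M)}. min 1 (dist (f t) (g t)))"
    using SUP_min_dist_upper[OF assms(1,2)] by (intro mult_left_mono) auto
  also have "\<dots> \<le> path_dist f g"
    unfolding path_dist_def
    using sum_le_suminf[OF path_dist_summable, of "{M}" f g]
      SUP_min_dist_bounds(1)[of "real (Suc _)" f g]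
    by (simp add: mult_nonneg_nonneg)
  also have "\<dots> < (1 / 2) ^ Suc M * \<eta>" by fact
  finally have "min 1 (dist (f s) (g s)) < \<eta>" by (simp add: mult_less_cancel_left_pos)
  then show ?thesis using assms(4) by (auto simp: min_def split: if_splits)
qed

text \<open>Splits the series at \<open>N\<close>. The first \<open>N\<close> terms concern only
  times up to \<open>N\<close> and have weights of sum at most 1; in the tail truncated distances
  are at most 1 and the weights sum to \<open>(1 / 2) ^ N\<close>.\<close>

lemma path_dist_le:
  assumes "\<And>t. 0 \<le> t \<Longrightarrow> t \<le> real N \<Longrightarrow> dist (f t) (g t) \<le> \<eta>" "0 \<le> \<eta>"
  shows "path_dist f g \<le> \<eta> + (1 / 2) ^ N"
proof -
  define a where "a n = (1 / 2 :: real) ^ Suc n * (SUP t\<in>{0..real (Suc n)}. min 1 (dist (f t) (g t)))" for n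
  have geo: "(\<lambda>n. (1 / 2 :: real) ^ Suc n) sums 1"
    using power_half_series by simp
  have sm: "summable a" unfolding a_def by (rule path_dist_summable)
  have "path_dist f g = (\<Sum>n. a (n + N)) + (\<Sum>n<N. a n)"
    unfolding path_dist_def a_def[symmetric] by (rule suminf_split_initial_segment[OF sm])
  also have "(\<Sum>n. a (n + N)) \<le> (\<Sum>n. (1 / 2) ^ Suc n * (1 / 2) ^ N)"
  proof (rule suminf_le)
    show "a (n + N) \<le> (1 / 2) ^ Suc n * (1 / 2) ^ N" for n
      using SUP_min_dist_bounds(2)[of "real (Suc (n + N))" f g]
      by (simp add: a_def power_add mult_left_le)
    show "summable (\<lambda>n. a (n + N))" by (rule summable_ignore_initial_segment[OF sm])
    show "summable (\<lambda>n. (1 / 2 :: real) ^ Suc n * (1 / 2) ^ N)"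
      using geo by (intro summable_mult2) (simp add: sums_iff)
  qed
  also have "(\<Sum>n. (1 / 2 :: real) ^ Suc n * (1 / 2) ^ N) = (1 / 2) ^ N"
    using geo by (subst suminf_mult2[symmetric]) (simp_all add: sums_iff)
  also have "(\<Sum>n<N. a n) \<le> (\<Sum>n<N. (1 / 2) ^ Suc n * \<eta>)"
  proof (rule sum_mono)
    fix n assume n: "n \<in> {..<N}"
    have "(SUP t\<in>{0..real (Suc n)}. min 1 (dist (f t) (g t))) \<le> \<eta>"
    proof (rule cSUP_least)
      fix t assume "t \<in> {0..real (Suc n)}"
      then have "0 \<le> t" "t \<le> real N" using n by auto
      from assms(1)[OF this] show "min 1 (dist (f t) (g t)) \<le> \<eta>" by simp
    qed auto
    then show "a n \<le> (1 / 2) ^ Suc n * \<eta>" unfolding a_def by (intro mult_left_mono) auto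
  qed
  also have "\<dots> = (\<Sum>n<N. (1 / 2) ^ Suc n) * \<eta>" by (simp add: sum_distrib_right)
  also have "\<dots> \<le> 1 * \<eta>"
    using geo assms(2) sum_le_suminf[of "\<lambda>n. (1 / 2 :: real) ^ Suc n" "{..<N}"]
    by (intro mult_right_mono) (auto simp: sums_iff)
  finally show ?thesis by simp
qed

section \<open>Density of rational points and of polygonal paths\<close>

lemma rat_of_code_dense:
  assumes "0 < e" shows "\<exists>c. \<bar>rat_of_code c - x\<bar> < e"
proof -
  obtain b where b: "inverse (real (Suc b)) < e" using reals_Archimedean[OF assms] by blast
  define a where "a = \<lfloor>x * real (Suc b)\<rfloor>"
  have "\<bar>real_of_int a / real (Suc b) - x\<bar> = \<bar>real_of_int a - x * real (Suc b)\<bar> / real (Suc b)"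
    by (simp add: field_simps abs_divide[symmetric] del: of_nat_Suc)
  also have "\<dots> \<le> 1 / real (Suc b)" unfolding a_def by (intro divide_right_mono) linarith+
  also have "\<dots> < e" using b by (simp add: field_simps)
  finally show ?thesis
    by (intro exI[of _ "prod_encode (int_encode a, b)"]) (simp add: rat_of_code_def del: of_nat_Suc)
qed

lemma ratpoint_of_code_dense:
  assumes "0 < e" shows "\<exists>c. dist (ratpoint_of_code c) z < e"
proof -
  obtain a b where ab: "\<bar>rat_of_code a - fst z\<bar> < e / 2" "\<bar>rat_of_code b - snd z\<bar> < e / 2"
    using rat_of_code_dense[of "e / 2"] assms by (meson half_gt_zero)
  have "dist (rat_of_code a, rat_of_code b) z
      \<le> \<bar>rat_of_code a - fst z\<bar> + \<bar>rat_of_code b - snd z\<bar>"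
    unfolding dist_prod_def dist_real_def fst_conv snd_conv
    using sqrt_sum_squares_le_sum_abs[of "\<bar>rat_of_code a - fst z\<bar>" "\<bar>rat_of_code b - snd z\<bar>"] by simp
  then show ?thesis using ab
    by (intro exI[of _ "prod_encode (a, b)"]) (simp add: ratpoint_of_code_def)
qed

text \<open>The hat functions form a partition of unity. In the induction step, past
  \<open>n\<close> only the last two hats are nonzero, and on that interval they add up to
  1.\<close>

lemma sum_hat_functions:
  assumes "0 \<le> x" "x \<le> real n"
  shows "(\<Sum>k<Suc n. max 0 (1 - \<bar>x - real k\<bar>)) = 1"
  using assms
proof (induction n)
  case (Suc n)
  show ?case
  proof (cases "x \<le> real n")
    case True
    then show ?thesis using Suc by simp
  next
    case False
    then have "(\<Sum>k<n. max 0 (1 - \<bar>x - real k\<bar>)) = 0" by (intro sum.neutral) auto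
    with False Suc.prems show ?thesis by simp
  qed
qed simp

lemma polygonal_path_node:
  assumes "j < length cs"
  shows "polygonal_path m cs (real j / real (Suc m)) = ratpoint_of_code (cs ! j)"
proof -
  have "polygonal_path m cs (real j / real (Suc m))
      = (\<Sum>k<length cs. max 0 (1 - \<bar>real j - real k\<bar>) *\<^sub>R ratpoint_of_code (cs ! k))"
    by (simp add: polygonal_path_def del: of_nat_Suc)
  also have "\<dots> = (\<Sum>k<length cs. if k = j then ratpoint_of_code (cs ! k) else 0)"
  proof (intro sum.cong refl)
    fix k
    have "max 0 (1 - \<bar>real j - real k\<bar>) = (if k = j then 1 else 0)"
      by (cases k j rule: linorder_cases) auto
    then show "max 0 (1 - \<bar>real j - real k\<bar>) *\<^sub>R ratpoint_of_code (cs ! k)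
        = (if k = j then ratpoint_of_code (cs ! k) else 0)" by simp
  qed
  also have "\<dots> = ratpoint_of_code (cs ! j)" using assms by (simp add: sum.delta)
  finally show ?thesis .
qed

text \<open>At each time the path is a convex combination of the values at breakpoints less than
  \<open>1 / (m + 1)\<close> away, hence as close to \<open>w\<close> as those values are.\<close>

lemma polygonal_path_approximation:
  assumes \<tau>: "0 \<le> \<tau>" "real (Suc m) * \<tau> \<le> real n" and len: "length cs = Suc n"
    and near: "\<And>k. k \<le> n \<Longrightarrow> \<bar>\<tau> - real k / real (Suc m)\<bar> < 1 / real (Suc m) \<Longrightarrow>
      dist (ratpoint_of_code (cs ! k)) w \<le> \<eta>"
  shows "dist (polygonal_path m cs \<tau>) w \<le> \<eta>"
proof -
  define h where "h k = max 0 (1 - \<bar>real (Suc m) * \<tau> - real k\<bar>)" for k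
  have h: "0 \<le> h k" for k by (simp add: h_def)
  have h1: "(\<Sum>k<Suc n. h k) = 1" unfolding h_def using \<tau> by (intro sum_hat_functions) auto
  have "polygonal_path m cs \<tau> - w = (\<Sum>k<Suc n. h k *\<^sub>R ratpoint_of_code (cs ! k)) - (\<Sum>k<Suc n. h k) *\<^sub>R w"
    using \<tau> unfolding h1 by (simp add: polygonal_path_def len h_def del: sum.lessThan_Suc of_nat_Suc)
  also have "\<dots> = (\<Sum>k<Suc n. h k *\<^sub>R (ratpoint_of_code (cs ! k) - w))"
    by (simp add: scaleR_sum_left sum_subtractf scaleR_diff_right del: sum.lessThan_Suc)
  finally have "dist (polygonal_path m cs \<tau>) w = norm \<dots>" by (simp only: dist_norm)
  also have "\<dots> \<le> (\<Sum>k<Suc n. h k * \<eta>)"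
  proof (rule sum_norm_le)
    fix k assume k: "k \<in> {..<Suc n}"
    show "norm (h k *\<^sub>R (ratpoint_of_code (cs ! k) - w)) \<le> h k * \<eta>"
    proof (cases "h k = 0")
      case False
      then have "\<bar>real (Suc m) * \<tau> - real k\<bar> < 1" by (auto simp: h_def max_def split: if_splits)
      then have "\<bar>real (Suc m) * \<tau> - real k\<bar> / real (Suc m) < 1 / real (Suc m)"
        by (intro divide_strict_right_mono) auto
      also have "\<bar>real (Suc m) * \<tau> - real k\<bar> / real (Suc m) = \<bar>(real (Suc m) * \<tau> - real k) / real (Suc m)\<bar>"
        by (simp add: abs_divide)
      also have "(real (Suc m) * \<tau> - real k) / real (Suc m) = \<tau> - real k / real (Suc m)"
        by (simp add: diff_divide_distrib del: of_nat_Suc)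
      finally have "dist (ratpoint_of_code (cs ! k)) w \<le> \<eta>" using k by (intro near) auto
      then show ?thesis using h[of k] by (simp add: dist_norm mult_left_mono)
    qed simp
  qed
  also have "\<dots> = \<eta>" using h1 by (simp only: sum_distrib_right[symmetric])
  finally show ?thesis .
qed

text \<open>Interpolates \<open>B\<close> on a fine grid, except that the value at one node close to
  \<open>t\<close> is forced to be the given code \<open>c\<close>. Node values are then within
  \<open>r / 4\<close> of the path, interpolation costs another \<open>r / 8\<close>, and the tail
  of the metric less than \<open>r / 4\<close>.\<close>

lemma polygonal_path_dense:
  assumes B: "B \<in> path_space" and t: "0 \<le> t" "t \<le> real T" and r: "0 < r"
    and c: "dist (ratpoint_of_code c) (B t) \<le> r / 8"
  shows "\<exists>m cs j. j < length cs \<and> j \<le> Suc m * T \<and> cs ! j = c \<and> path_dist (polygonal_path m cs) B < r"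
proof -
  obtain N0 where N0: "(1 / 2 :: real) ^ N0 < r / 4"
    using real_arch_pow_inv[of "r / 4" "1 / 2"] r by auto
  \<comment> \<open>\<open>N0\<close> controls the tail of the metric; \<open>T\<close> ensures that
    \<open>t\<close> lies in the interval on which the path is approximated.\<close>
  define N where "N = max N0 T"
  have "(1 / 2 :: real) ^ N \<le> (1 / 2) ^ N0" by (rule power_decreasing) (auto simp: N_def)
  with N0 have N: "(1 / 2 :: real) ^ N < r / 4" "T \<le> N" by (linarith, simp add: N_def)
  have "continuous_on {0..real N} B"
    using B by (auto simp: path_space_def intro: continuous_on_subset)
  then have "uniformly_continuous_on {0..real N} B"
    by (intro compact_uniformly_continuous) auto
  then obtain d where d: "0 < d"
    "\<And>x y. x \<in> {0..real N} \<Longrightarrow> y \<in> {0..real N} \<Longrightarrow> \<bar>x - y\<bar> < d \<Longrightarrow> dist (B x) (B y) < r / 8"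
    using r unfolding uniformly_continuous_on_def dist_real_def
    by (metis (no_types, lifting) dist_commute half_gt_zero zero_less_divide_iff zero_less_numeral)
  obtain m where m: "1 / real (Suc m) < d"
    using reals_Archimedean[OF d(1)] by (auto simp: inverse_eq_divide)
  define n where "n = Suc m * N"
  have node: "real k / real (Suc m) \<in> {0..real N}" if "k \<le> n" for k
  proof -
    have "real k \<le> real N * real (Suc m)"
      using that unfolding n_def of_nat_mult[symmetric] of_nat_le_iff by (simp only: mult.commute)
    then show ?thesis by (simp add: pos_divide_le_eq del: of_nat_Suc)
  qed
  \<comment> \<open>The last node not after \<open>t\<close>. Rounding down keeps its time at most
    \<open>T\<close>.\<close>
  define j where "j = nat \<lfloor>t * real (Suc m)\<rfloor>"
  have j': "real j \<le> t * real (Suc m)" "t * real (Suc m) < real j + 1"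
    using t(1) unfolding j_def by (simp_all add: of_nat_nat del: of_nat_Suc)
  have "real j \<le> real T * real (Suc m)"
    using j'(1) mult_right_mono[OF t(2), of "real (Suc m)"] by linarith
  then have jT: "j \<le> Suc m * T"
    unfolding of_nat_mult[symmetric] of_nat_le_iff by (simp only: mult.commute)
  also have "Suc m * T \<le> n" using N(2) unfolding n_def by (rule mult_le_mono2)
  finally have jn: "j \<le> n" .
  have "\<bar>real j / real (Suc m) - t\<bar> < 1 / real (Suc m)"
    using j' by (auto simp: abs_less_iff pos_divide_less_eq pos_less_divide_eq left_diff_distrib
        simp del: of_nat_Suc)
  then have jt: "dist (B (real j / real (Suc m))) (B t) < r / 8"
    using t N(2) node[OF jn] m by (intro d(2)) auto
  have "\<forall>k. \<exists>c. dist (ratpoint_of_code c) (B (real k / real (Suc m))) < r / 8"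
    using ratpoint_of_code_dense[of "r / 8"] r by simp
  then obtain ch where ch: "\<And>k. dist (ratpoint_of_code (ch k)) (B (real k / real (Suc m))) < r / 8"
    by metis
  define cs where "cs = map (ch(j := c)) [0..<Suc n]"
  have len: "length cs = Suc n" and nth: "\<And>k. k \<le> n \<Longrightarrow> cs ! k = (ch(j := c)) k"
    by (auto simp: cs_def less_Suc_eq_le simp del: upt_Suc)
  \<comment> \<open>At node \<open>j\<close> two errors of \<open>r / 8\<close> add up: that of
    \<open>c\<close> against \<open>B t\<close>, and that of \<open>B t\<close> against the value of
    the path at the node.\<close>
  have close: "dist (ratpoint_of_code (cs ! k)) (B (real k / real (Suc m))) \<le> r / 4" if k: "k \<le> n" for k
  proof (cases "k = j")
    case True
    have "dist (ratpoint_of_code c) (B (real k / real (Suc m))) \<le> r / 8 + r / 8"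
      using c jt dist_triangle2[of "ratpoint_of_code c" "B (real k / real (Suc m))" "B t"] True by auto
    then show ?thesis using True k by (simp add: nth)
  next
    case False
    then show ?thesis using ch[of k] k r by (simp add: nth)
  qed
  have "path_dist (polygonal_path m cs) B \<le> 3 * r / 8 + (1 / 2) ^ N"
  proof (rule path_dist_le)
    fix \<tau> assume \<tau>: "0 \<le> \<tau>" "\<tau> \<le> real N"
    show "dist (polygonal_path m cs \<tau>) (B \<tau>) \<le> 3 * r / 8"
    proof (rule polygonal_path_approximation[OF \<tau>(1) _ len])
      show "real (Suc m) * \<tau> \<le> real n"
        unfolding n_def of_nat_mult using \<tau> by (intro mult_left_mono) auto
      fix k assume k: "k \<le> n" "\<bar>\<tau> - real k / real (Suc m)\<bar> < 1 / real (Suc m)"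
      have "dist (B \<tau>) (B (real k / real (Suc m))) < r / 8"
        using \<tau> node[OF k(1)] k(2) m by (intro d(2)) auto
      with close[OF k(1)] dist_triangle2[of "ratpoint_of_code (cs ! k)" "B \<tau>" "B (real k / real (Suc m))"]
      show "dist (ratpoint_of_code (cs ! k)) (B \<tau>) \<le> 3 * r / 8" by linarith
    qed
  qed (use r in simp)
  also have "\<dots> < r" using N(1) r by linarith
  finally show ?thesis
    using jT jn len nth[OF jn] by (intro exI[of _ m] exI[of _ cs] exI[of _ j]) auto
qed

section \<open>Effectively open sets of paths that approach a named point\<close>

text \<open>The integer 1 has code 2, since \<open>int_encode\<close> doubles nonnegative integers;
  the second component \<open>b\<close> stands for the denominator \<open>b + 1\<close>.\<close>

lemma mem_ideal_ball:
  "B \<in> ideal_ball (prod_encode (prod_encode (m, list_encode cs), prod_encode (2, b)))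
    \<longleftrightarrow> B \<in> path_space \<and> path_dist (polygonal_path m cs) B < 1 / real (Suc b)"
proof -
  have "int_decode 2 = 1" using int_encode_inverse[of 1] by (simp add: int_encode_def sum_encode_def)
  then show ?thesis
    using ideal_path_in_path_space[of "prod_encode (m, list_encode cs)"]
    by (auto simp: ideal_ball_def ideal_path_def rat_of_code_def Metric_space.in_mball[OF Metric_space_path])
qed

text \<open>The centres are required to take exactly the value with code \<open>p (e + 4)\<close> at one of their
  breakpoints, so that membership is decided by comparing codes and involves no real arithmetic.
  The code \<open>prod_encode (2, 2 ^ e)\<close> denotes the radius \<open>1 / (2 ^ e + 1)\<close>.\<close>

definition approach_test :: "(nat \<Rightarrow> nat) \<Rightarrow> nat \<Rightarrow> nat \<Rightarrow> planar_path set" where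
  "approach_test p T e = {B. \<exists>m cs. (\<exists>j<length cs. j \<le> Suc m * T \<and> cs ! j = p (e + 4)) \<and>
     B \<in> ideal_ball (prod_encode (prod_encode (m, list_encode cs), prod_encode (2, 2 ^ e)))}"

lemma approach_test_captures:
  assumes "B \<in> path_space" "0 \<le> t" "t \<le> real T" "is_name p (B t)"
  shows "B \<in> approach_test p T e"
proof -
  have pos: "0 < 1 / real (Suc (2 ^ e))" by (simp del: of_nat_Suc)
  have "dist (ratpoint_of_code (p (e + 4))) (B t) \<le> (1 / 2) ^ (e + 4)"
    using assms(4) by (simp add: is_name_def)
  \<comment> \<open>The reason for the shift by 4:
    \<open>8 * (2 ^ e + 1) \<le> 2 ^ (e + 4)\<close>.\<close>
  also have "\<dots> \<le> 1 / real (Suc (2 ^ e)) / 8"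
    using one_le_power[of "2 :: real" e]
    by (simp add: power_add power_one_over pos_divide_le_eq pos_le_divide_eq add_pos_pos)
  finally obtain m cs j where "j < length cs" "j \<le> Suc m * T" "cs ! j = p (e + 4)"
    "path_dist (polygonal_path m cs) B < 1 / real (Suc (2 ^ e))"
    using polygonal_path_dense[OF assms(1-3) pos] by blast
  then show ?thesis using assms(1) unfolding approach_test_def mem_ideal_ball by blast
qed

text \<open>With \<open>e = L + M + 2\<close> the radius is below
  \<open>(1 / 2) ^ (M + 1) * (1 / 2) ^ (L + 1)\<close>, where the first factor is the weight the
  metric gives to \<open>{0..M + 1}\<close>. So at the breakpoint time the path is within
  \<open>(1 / 2) ^ (L + 1)\<close> of the named approximation, which is equally close to
  \<open>z\<close>.\<close>

lemma approach_test_sound: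
  assumes "B \<in> approach_test p (Suc M) (L + M + 2)" "is_name p z"
  shows "B \<in> path_space" "\<exists>s. 0 \<le> s \<and> s \<le> real (Suc M) \<and> dist (B s) z < (1 / 2) ^ L"
proof -
  let ?e = "L + M + 2"
  obtain m cs j where *: "j < length cs" "j \<le> Suc m * Suc M" "cs ! j = p (?e + 4)"
    "B \<in> path_space" "path_dist (polygonal_path m cs) B < 1 / real (Suc (2 ^ ?e))"
    using assms(1) unfolding approach_test_def mem_ideal_ball by auto
  show "B \<in> path_space" by fact
  define s where "s = real j / real (Suc m)"
  have "real j \<le> real (Suc M) * real (Suc m)"
    using *(2) unfolding of_nat_mult[symmetric] of_nat_le_iff by (simp only: mult.commute)
  then have s: "0 \<le> s" "s \<le> real (Suc M)"
    unfolding s_def by (simp_all add: pos_divide_le_eq del: of_nat_Suc)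
  have "1 / real (Suc (2 ^ ?e)) \<le> (1 / 2) ^ Suc M * (1 / 2) ^ Suc L"
    by (simp add: power_add power_one_over divide_simps add_pos_pos)
  with *(5) have "path_dist (polygonal_path m cs) B < (1 / 2) ^ Suc M * (1 / 2) ^ Suc L" by linarith
  from dist_less_of_path_dist[OF s this] have "dist (ratpoint_of_code (p (?e + 4))) (B s) < (1 / 2) ^ Suc L"
    using polygonal_path_node[OF *(1), of m] *(3) power_le_one[of "1 / 2 :: real" "Suc L"]
    by (simp add: s_def)
  moreover have "dist (ratpoint_of_code (p (?e + 4))) z \<le> (1 / 2) ^ Suc L"
  proof -
    have "dist (ratpoint_of_code (p (?e + 4))) z \<le> (1 / 2) ^ (?e + 4)"
      using assms(2) by (simp only: is_name_def)
    also have "\<dots> \<le> (1 / 2) ^ Suc L" by (rule power_decreasing) auto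
    finally show ?thesis .
  qed
  ultimately have "dist (B s) z < (1 / 2) ^ Suc L + (1 / 2) ^ Suc L"
    using dist_triangle3[of "B s" z "ratpoint_of_code (p (?e + 4))"] by linarith
  then show "\<exists>s. 0 \<le> s \<and> s \<le> real (Suc M) \<and> dist (B s) z < (1 / 2) ^ L"
    using s by (intro exI[of _ s]) auto
qed

section \<open>Hitting probabilities of planar Brownian motion\<close>

text \<open>On the interval the density is at most its value at \<open>d\<close>, and the length is
  \<open>2 * r\<close>. Taking \<open>d = 0\<close> gives the plain bound; a positive
  \<open>d\<close> keeps the exponential decay for intervals away from the origin.\<close>

lemma (in prob_space) normal_prob_interval_le:
  assumes Z: "distributed M lborel Z (\<lambda>x. ennreal (normal_density 0 (sqrt s) x))"
    and s: "0 < s" and r: "0 \<le> r" and d: "0 \<le> d" "\<And>x. \<bar>x - a\<bar> < r \<Longrightarrow> d \<le> \<bar>x\<bar>"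
  shows "prob {\<omega> \<in> space M. \<bar>Z \<omega> - a\<bar> < r} \<le> 2 * r / sqrt (2 * pi * s) * exp (- d\<^sup>2 / (2 * s))"
proof -
  let ?A = "{a - r<..<a + r}" and ?C = "1 / sqrt (2 * pi * s) * exp (- d\<^sup>2 / (2 * s))"
  have "normal_density 0 (sqrt s) x \<le> ?C" if "\<bar>x - a\<bar> < r" for x
  proof -
    have "d\<^sup>2 \<le> x\<^sup>2" using d that by (metis abs_of_nonneg abs_le_square_iff)
    then have "- x\<^sup>2 / (2 * s) \<le> - d\<^sup>2 / (2 * s)" using s by (intro divide_right_mono) auto
    then show ?thesis using s unfolding normal_density_def by (intro mult_mono) auto
  qed
  then have le: "ennreal (normal_density 0 (sqrt s) x) * indicator ?A x \<le> ennreal ?C * indicator ?A x" for x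
    by (auto simp: indicator_def abs_less_iff intro!: ennreal_leI)
  have "emeasure M (Z -` ?A \<inter> space M) = (\<integral>\<^sup>+x. ennreal (normal_density 0 (sqrt s) x) * indicator ?A x \<partial>lborel)"
    by (rule distributed_emeasure[OF Z]) simp
  also have "\<dots> \<le> (\<integral>\<^sup>+x. ennreal ?C * indicator ?A x \<partial>lborel)" by (rule nn_integral_mono) (rule le)
  also have "\<dots> = ennreal (?C * (2 * r))"
    using r by (subst nn_integral_cmult_indicator, simp, subst ennreal_mult'') simp_all
  finally have "prob (Z -` ?A \<inter> space M) \<le> ?C * (2 * r)"
    using s r by (subst (asm) emeasure_eq_measure, subst (asm) ennreal_le_iff) auto
  also have "Z -` ?A \<inter> space M = {\<omega> \<in> space M. \<bar>Z \<omega> - a\<bar> < r}"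
    by (auto simp: abs_less_iff)
  finally show ?thesis by (simp add: field_simps)
qed

text \<open>For \<open>\<bar>x\<bar> < r\<close> and \<open>r\<^sup>2 \<le> s\<close> the exponent
  is at least \<open>- 1 / 2\<close>, so \<open>1 + y \<le> exp y\<close> bounds the exponential
  below by \<open>1 / 2\<close>.\<close>

lemma (in prob_space) normal_prob_interval_ge:
  assumes Z: "distributed M lborel Z (\<lambda>x. ennreal (normal_density 0 (sqrt s) x))"
    and r: "0 < r" "r\<^sup>2 \<le> s"
  shows "r / sqrt (2 * pi * s) \<le> prob {\<omega> \<in> space M. \<bar>Z \<omega>\<bar> < r}"
proof -
  have s: "0 < s" using r zero_less_power[OF r(1), of 2] by linarith
  let ?A = "{- r<..<r}" and ?C = "1 / sqrt (2 * pi * s) * (1 / 2)"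
  have "?C \<le> normal_density 0 (sqrt s) x" if "\<bar>x\<bar> < r" for x
  proof -
    have "x\<^sup>2 \<le> r\<^sup>2" using that r(1) by (metis abs_le_square_iff abs_of_pos less_imp_le)
    then have "1 / 2 \<le> 1 + - x\<^sup>2 / (2 * s)" using r s by (simp add: field_simps)
    also have "\<dots> \<le> exp (- x\<^sup>2 / (2 * s))" by (rule exp_ge_add_one_self)
    finally show ?thesis using s unfolding normal_density_def by (intro mult_mono) auto
  qed
  then have le: "ennreal ?C * indicator ?A x \<le> ennreal (normal_density 0 (sqrt s) x) * indicator ?A x" for x
    by (auto simp: indicator_def abs_less_iff intro!: ennreal_leI)
  have "ennreal (?C * (2 * r)) = (\<integral>\<^sup>+x. ennreal ?C * indicator ?A x \<partial>lborel)"
    using r by (subst nn_integral_cmult_indicator, simp, subst ennreal_mult'') simp_all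
  also have "\<dots> \<le> (\<integral>\<^sup>+x. ennreal (normal_density 0 (sqrt s) x) * indicator ?A x \<partial>lborel)"
    by (rule nn_integral_mono) (rule le)
  also have "\<dots> = emeasure M (Z -` ?A \<inter> space M)"
    by (rule distributed_emeasure[OF Z, symmetric]) simp
  finally have "?C * (2 * r) \<le> prob (Z -` ?A \<inter> space M)"
    using s r by (subst (asm) emeasure_eq_measure, subst (asm) ennreal_le_iff) auto
  also have "Z -` ?A \<inter> space M = {\<omega> \<in> space M. \<bar>Z \<omega>\<bar> < r}"
    by (auto simp: abs_less_iff)
  finally show ?thesis by simp
qed

section \<open>Joint independence of planar increments\<close>

text \<open>The probability of a box factors first into the two vectors, by \<open>XY\<close>, and
  then within each vector. For finitely many variables such product formulas are all that
  independence asks.\<close>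

lemma (in prob_space) indep_vars_bool_Times:
  assumes I: "finite I" "I \<noteq> {}"
    and X: "indep_vars (\<lambda>_. N) X I" and Y: "indep_vars (\<lambda>_. N) Y I"
    and XY: "indep_var (Pi\<^sub>M I (\<lambda>_. N)) (\<lambda>\<omega>. \<lambda>i\<in>I. X i \<omega>) (Pi\<^sub>M I (\<lambda>_. N)) (\<lambda>\<omega>. \<lambda>i\<in>I. Y i \<omega>)"
  shows "indep_vars (\<lambda>_. N) (\<lambda>(b, i) \<omega>. if b then X i \<omega> else Y i \<omega>) (UNIV \<times> I)"
proof -
  let ?Z = "\<lambda>(b, i) \<omega>. if b then X i \<omega> else Y i \<omega>"
  have rv: "random_variable N (X i)" "random_variable N (Y i)" if "i \<in> I" for i
    using X Y that by (auto simp: indep_vars_def)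
  have "prob (\<Inter>j\<in>UNIV \<times> I. ?Z j -` A j \<inter> space M) = (\<Prod>j\<in>UNIV \<times> I. prob (?Z j -` A j \<inter> space M))"
    if A: "A \<in> UNIV \<times> I \<rightarrow> sets N" for A
  proof -
    have A': "A (b, i) \<in> sets N" if "i \<in> I" for b i using A that by auto
    have "(\<Inter>j\<in>UNIV \<times> I. ?Z j -` A j \<inter> space M)
        = (\<lambda>\<omega>. (\<lambda>i\<in>I. X i \<omega>, \<lambda>i\<in>I. Y i \<omega>)) -`
          ((\<Pi>\<^sub>E i\<in>I. A (True, i)) \<times> (\<Pi>\<^sub>E i\<in>I. A (False, i))) \<inter> space M"
      using I by (auto simp: PiE_iff all_bool_eq split: if_splits)
    also have "prob \<dots> = prob ((\<lambda>\<omega>. \<lambda>i\<in>I. X i \<omega>) -` (\<Pi>\<^sub>E i\<in>I. A (True, i)) \<inter> space M)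
        * prob ((\<lambda>\<omega>. \<lambda>i\<in>I. Y i \<omega>) -` (\<Pi>\<^sub>E i\<in>I. A (False, i)) \<inter> space M)"
      using I A' by (intro indep_varD[OF XY] sets_PiM_I_finite) auto
    also have "(\<lambda>\<omega>. \<lambda>i\<in>I. X i \<omega>) -` (\<Pi>\<^sub>E i\<in>I. A (True, i)) \<inter> space M
        = (\<Inter>i\<in>I. X i -` A (True, i) \<inter> space M)"
      using I by (auto simp: PiE_iff)
    also have "(\<lambda>\<omega>. \<lambda>i\<in>I. Y i \<omega>) -` (\<Pi>\<^sub>E i\<in>I. A (False, i)) \<inter> space M
        = (\<Inter>i\<in>I. Y i -` A (False, i) \<inter> space M)"
      using I by (auto simp: PiE_iff)
    also have "prob (\<Inter>i\<in>I. X i -` A (True, i) \<inter> space M) = (\<Prod>i\<in>I. prob (X i -` A (True, i) \<inter> space M))"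
      using I A' by (intro indep_varsD_finite[OF X]) auto
    also have "prob (\<Inter>i\<in>I. Y i -` A (False, i) \<inter> space M) = (\<Prod>i\<in>I. prob (Y i -` A (False, i) \<inter> space M))"
      using I A' by (intro indep_varsD_finite[OF Y]) auto
    also have "(\<Prod>i\<in>I. prob (X i -` A (True, i) \<inter> space M)) * (\<Prod>i\<in>I. prob (Y i -` A (False, i) \<inter> space M))
        = (\<Prod>b\<in>UNIV. \<Prod>i\<in>I. prob (?Z (b, i) -` A (b, i) \<inter> space M))"
      by (simp add: UNIV_bool mult.commute)
    also have "\<dots> = (\<Prod>j\<in>UNIV \<times> I. prob (?Z j -` A j \<inter> space M))"
      by (simp add: prod.cartesian_product case_prod_beta)
    finally show ?thesis .
  qed
  then show ?thesis
    using I rv by (subst indep_vars_finite[where E = "\<lambda>_. sets N"])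
      (auto simp: sets.sigma_sets_eq sets.Int_stable dest: sets.sets_into_space)
qed

locale planar_brownian_motion = prob_space +
  fixes X Y :: "real \<Rightarrow> 'a \<Rightarrow> real"
  assumes X: "standard_brownian_motion M X" and Y: "standard_brownian_motion M Y"
    and XY: "indep_var (Pi\<^sub>M {0..} (\<lambda>_. borel)) (\<lambda>\<omega>. \<lambda>t\<in>{0..}. X t \<omega>)
      (Pi\<^sub>M {0..} (\<lambda>_. borel)) (\<lambda>\<omega>. \<lambda>t\<in>{0..}. Y t \<omega>)"
begin

lemma measurable_coordinates:
  assumes "0 \<le> t"
  shows "X t \<in> borel_measurable M" "Y t \<in> borel_measurable M"
  using X Y assms by (auto simp: standard_brownian_motion_def)

lemma increment_distributed:
  assumes "0 \<le> s" "s < t"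
  shows "distributed M lborel (\<lambda>\<omega>. X t \<omega> - X s \<omega>) (\<lambda>x. ennreal (normal_density 0 (sqrt (t - s)) x))"
    and "distributed M lborel (\<lambda>\<omega>. Y t \<omega> - Y s \<omega>) (\<lambda>x. ennreal (normal_density 0 (sqrt (t - s)) x))"
  using X Y assms by (auto simp: standard_brownian_motion_def)

lemma prob_planar_increment:
  assumes st: "0 \<le> s" "0 \<le> t" and U: "U \<in> sets borel" and V: "V \<in> sets borel"
  shows "prob {\<omega> \<in> space M. X t \<omega> - X s \<omega> \<in> U \<and> Y t \<omega> - Y s \<omega> \<in> V}
    = prob {\<omega> \<in> space M. X t \<omega> - X s \<omega> \<in> U} * prob {\<omega> \<in> space M. Y t \<omega> - Y s \<omega> \<in> V}"
proof -
  let ?D = "\<lambda>x. x t - x s :: real"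
  have D: "?D \<in> borel_measurable (Pi\<^sub>M {0..} (\<lambda>_. borel))"
    using st by (intro borel_measurable_diff measurable_component_singleton) auto
  have "indep_var borel (?D \<circ> (\<lambda>\<omega>. \<lambda>t\<in>{0..}. X t \<omega>)) borel (?D \<circ> (\<lambda>\<omega>. \<lambda>t\<in>{0..}. Y t \<omega>))"
    by (rule indep_var_compose[OF XY D D])
  from indep_varD[OF this U V] st show ?thesis
    by (simp add: vimage_def Int_def conj_commute comp_def)
qed

text \<open>Independence within each coordinate is part of being a Brownian motion. Independence of
  the two whole processes passes to the vectors of increments, which are measurable images
  \<open>?D\<close> of them.\<close>

lemma indep_vars_increments:
  assumes t: "0 \<le> t 0" "\<And>k. k < n \<Longrightarrow> t k < t (Suc k)" and n: "0 < n"
  shows "indep_vars (\<lambda>_. borel)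
    (\<lambda>(b, k) \<omega>. if b then X (t (Suc k)) \<omega> - X (t k) \<omega> else Y (t (Suc k)) \<omega> - Y (t k) \<omega>)
    (UNIV \<times> {..<n})"
proof -
  have t0: "0 \<le> t k" if "k \<le> n" for k
    using that by (induction k) (use t in \<open>auto intro: less_imp_le order_trans simp: Suc_le_eq\<close>)
  let ?D = "\<lambda>x. \<lambda>k\<in>{..<n}. x (t (Suc k)) - x (t k) :: real"
  have D: "?D \<in> measurable (Pi\<^sub>M {0..} (\<lambda>_. borel)) (Pi\<^sub>M {..<n} (\<lambda>_. borel))"
    using t0 by (intro measurable_restrict borel_measurable_diff measurable_component_singleton) auto
  have eq: "?D \<circ> (\<lambda>\<omega>. \<lambda>t\<in>{0..}. Z t \<omega>) = (\<lambda>\<omega>. \<lambda>k\<in>{..<n}. Z (t (Suc k)) \<omega> - Z (t k) \<omega>)"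
    for Z :: "real \<Rightarrow> 'a \<Rightarrow> real"
    using t0 by (auto simp: fun_eq_iff restrict_def)
  show ?thesis
  proof (rule indep_vars_bool_Times)
    show "indep_vars (\<lambda>_. borel) (\<lambda>k \<omega>. X (t (Suc k)) \<omega> - X (t k) \<omega>) {..<n}"
      "indep_vars (\<lambda>_. borel) (\<lambda>k \<omega>. Y (t (Suc k)) \<omega> - Y (t k) \<omega>) {..<n}"
      using X Y t unfolding standard_brownian_motion_def by blast+
    show "indep_var (Pi\<^sub>M {..<n} (\<lambda>_. borel)) (\<lambda>\<omega>. \<lambda>k\<in>{..<n}. X (t (Suc k)) \<omega> - X (t k) \<omega>)
      (Pi\<^sub>M {..<n} (\<lambda>_. borel)) (\<lambda>\<omega>. \<lambda>k\<in>{..<n}. Y (t (Suc k)) \<omega> - Y (t k) \<omega>)"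
      using indep_var_compose[OF XY D D] unfolding eq .
  qed (use n in auto)
qed

section \<open>Entrances into small squares along a grid\<close>

text \<open>Measures the displacement since time 0 instead of the position, so that on a grid it is
  exactly a sum of increments; the start at the origin holds only almost surely.\<close>

definition near :: "real \<Rightarrow> real \<times> real \<Rightarrow> real \<Rightarrow> 'a set" where
  "near r z t = {\<omega> \<in> space M. \<bar>X t \<omega> - X 0 \<omega> - fst z\<bar> < r \<and> \<bar>Y t \<omega> - Y 0 \<omega> - snd z\<bar> < r}"

definition moves_less :: "real \<Rightarrow> real \<Rightarrow> real \<Rightarrow> 'a set" where
  "moves_less r s t = {\<omega> \<in> space M. \<bar>X t \<omega> - X s \<omega>\<bar> < r \<and> \<bar>Y t \<omega> - Y s \<omega>\<bar> < r}"

definition first_near :: "real \<Rightarrow> real \<times> real \<Rightarrow> real \<Rightarrow> nat \<Rightarrow> 'a set" where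
  "first_near r z h i = near r z (real i * h) - (\<Union>l<i. near r z (real l * h))"

lemma sets_near: "0 \<le> t \<Longrightarrow> near r z t \<in> events"
  unfolding near_def
  using measurable_coordinates[of t] measurable_coordinates[of 0] by measurable

lemma sets_first_near: "0 \<le> h \<Longrightarrow> first_near r z h i \<in> events"
  unfolding first_near_def by (intro sets.Diff sets.finite_UN sets_near) auto

text \<open>The Markov property in elementary form: a first entrance at index \<open>i\<close> is
  decided by the increments up to time \<open>i * h\<close>, and the later displacement is one
  further, independent increment.\<close>

lemma prob_first_near_moves_less:
  assumes h: "0 < h" and ij: "i < j"
  shows "prob (first_near r z h i \<inter> moves_less r (real i * h) (real j * h))
    = prob (first_near r z h i) * prob (moves_less r (real i * h) (real j * h))"
proof -
  \<comment> \<open>the grid up to time \<open>i * h\<close>, followed by a single increment up to time \<open>j * h\<close>\<close>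
  define t where "t k = (if k \<le> i then real k * h else real j * h)" for k
  define Z where "Z = (\<lambda>(b, k) \<omega>. if b then X (t (Suc k)) \<omega> - X (t k) \<omega> else Y (t (Suc k)) \<omega> - Y (t k) \<omega>)"
  let ?P = "UNIV \<times> {..<i}" and ?F = "UNIV \<times> {i}"
  have tmono: "t k < t (Suc k)" if "k < Suc i" for k
    using that h ij by (auto simp: t_def le_less_Suc_eq not_less_eq_eq)
  have "indep_vars (\<lambda>_. borel) Z (UNIV \<times> {..<Suc i})"
    unfolding Z_def by (rule indep_vars_increments) (use tmono in \<open>auto simp: t_def\<close>)
  then have ind: "indep_var (Pi\<^sub>M ?P (\<lambda>_. borel)) (\<lambda>\<omega>. \<lambda>x\<in>?P. Z x \<omega>) (Pi\<^sub>M ?F (\<lambda>_. borel)) (\<lambda>\<omega>. \<lambda>x\<in>?F. Z x \<omega>)"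
    by (rule indep_var_restrict) auto
  \<comment> \<open>\<open>N l\<close> and \<open>G\<close> describe the events as sets of increment
    vectors, past and future respectively; telescoping sums recover the displacements.\<close>
  define N where "N l = {x \<in> space (Pi\<^sub>M ?P (\<lambda>_. borel)).
    \<bar>(\<Sum>k<l. x (True, k)) - fst z\<bar> < r \<and> \<bar>(\<Sum>k<l. x (False, k)) - snd z\<bar> < r}" for l
  have N: "N l \<in> sets (Pi\<^sub>M ?P (\<lambda>_. borel))" if "l \<le> i" for l
  proof -
    have "(\<lambda>x. \<Sum>k<l. x (b, k)) \<in> borel_measurable (Pi\<^sub>M ?P (\<lambda>_. borel :: real measure))" for b
      using that by (intro borel_measurable_sum measurable_component_singleton) auto
    note this[measurable]
    show ?thesis unfolding N_def by measurable
  qed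
  define G where "G = {x \<in> space (Pi\<^sub>M ?F (\<lambda>_. borel :: real measure)). \<bar>x (True, i)\<bar> < r \<and> \<bar>x (False, i)\<bar> < r}"
  have G: "G \<in> sets (Pi\<^sub>M ?F (\<lambda>_. borel))"
  proof -
    have "(\<lambda>x. x (b, i)) \<in> borel_measurable (Pi\<^sub>M ?F (\<lambda>_. borel :: real measure))" for b
      by (intro measurable_component_singleton) auto
    note this[measurable]
    show ?thesis unfolding G_def by measurable
  qed
  have tel: "(\<Sum>k<l. (\<lambda>x\<in>?P. Z x \<omega>) (True, k)) = X (real l * h) \<omega> - X 0 \<omega>"
    "(\<Sum>k<l. (\<lambda>x\<in>?P. Z x \<omega>) (False, k)) = Y (real l * h) \<omega> - Y 0 \<omega>" if "l \<le> i" for l \<omega>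
  proof -
    have "(\<Sum>k<l. (\<lambda>x\<in>?P. Z x \<omega>) (True, k)) = (\<Sum>k<l. X (t (Suc k)) \<omega> - X (t k) \<omega>)"
      "(\<Sum>k<l. (\<lambda>x\<in>?P. Z x \<omega>) (False, k)) = (\<Sum>k<l. Y (t (Suc k)) \<omega> - Y (t k) \<omega>)"
      using that by (auto intro!: sum.cong simp: Z_def)
    then show "(\<Sum>k<l. (\<lambda>x\<in>?P. Z x \<omega>) (True, k)) = X (real l * h) \<omega> - X 0 \<omega>"
      "(\<Sum>k<l. (\<lambda>x\<in>?P. Z x \<omega>) (False, k)) = Y (real l * h) \<omega> - Y 0 \<omega>"
      using that sum_lessThan_telescope[of "\<lambda>k. X (t k) \<omega>" l] sum_lessThan_telescope[of "\<lambda>k. Y (t k) \<omega>" l]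
      by (simp_all add: t_def)
  qed
  have nearN: "\<omega> \<in> near r z (real l * h) \<longleftrightarrow> (\<lambda>x\<in>?P. Z x \<omega>) \<in> N l"
    if "\<omega> \<in> space M" "l \<le> i" for l \<omega>
    using that tel[OF that(2), of \<omega>] unfolding near_def N_def
    by (simp add: space_PiM del: restrict_apply)
  have first: "first_near r z h i = (\<lambda>\<omega>. \<lambda>x\<in>?P. Z x \<omega>) -` (N i - (\<Union>l<i. N l)) \<inter> space M"
  proof (intro set_eqI)
    fix \<omega>
    show "\<omega> \<in> first_near r z h i \<longleftrightarrow> \<omega> \<in> (\<lambda>\<omega>. \<lambda>x\<in>?P. Z x \<omega>) -` (N i - (\<Union>l<i. N l)) \<inter> space M"
    proof (cases "\<omega> \<in> space M")
      case True
      then show ?thesis unfolding first_near_def using nearN[OF True] by simp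
    qed (simp add: first_near_def near_def)
  qed
  have moves: "moves_less r (real i * h) (real j * h) = (\<lambda>\<omega>. \<lambda>x\<in>?F. Z x \<omega>) -` G \<inter> space M"
    unfolding moves_less_def G_def by (auto simp: space_PiM Z_def t_def)
  have "prob ((\<lambda>\<omega>. (\<lambda>x\<in>?P. Z x \<omega>, \<lambda>x\<in>?F. Z x \<omega>)) -` ((N i - (\<Union>l<i. N l)) \<times> G) \<inter> space M)
      = prob (first_near r z h i) * prob (moves_less r (real i * h) (real j * h))"
    unfolding first moves using N G
    by (intro indep_varD[OF ind] sets.Diff sets.finite_UN) auto
  also have "(\<lambda>\<omega>. (\<lambda>x\<in>?P. Z x \<omega>, \<lambda>x\<in>?F. Z x \<omega>)) -` ((N i - (\<Union>l<i. N l)) \<times> G) \<inter> space M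
      = first_near r z h i \<inter> moves_less r (real i * h) (real j * h)"
    unfolding first moves by auto
  finally show ?thesis .
qed

lemma prob_moves_less_ge:
  assumes st: "0 \<le> s" "s < t" and r: "0 < r" "r\<^sup>2 \<le> t - s"
  shows "r\<^sup>2 / (2 * pi * (t - s)) \<le> prob (moves_less r s t)"
proof -
  let ?u = "r / sqrt (2 * pi * (t - s))"
  have "?u \<le> prob {\<omega> \<in> space M. \<bar>X t \<omega> - X s \<omega>\<bar> < r}" "?u \<le> prob {\<omega> \<in> space M. \<bar>Y t \<omega> - Y s \<omega>\<bar> < r}"
    using st r by (auto intro!: normal_prob_interval_ge increment_distributed)
  then have "?u * ?u \<le> prob {\<omega> \<in> space M. \<bar>X t \<omega> - X s \<omega>\<bar> < r} * prob {\<omega> \<in> space M. \<bar>Y t \<omega> - Y s \<omega>\<bar> < r}"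
    using st r by (intro mult_mono) auto
  also have "\<dots> = prob (moves_less r s t)"
    using prob_planar_increment[of s t "{-r<..<r}" "{-r<..<r}"] st
    by (simp add: moves_less_def abs_less_iff conj_commute minus_less_iff[of r])
  finally show ?thesis using st by (simp add: power2_eq_square)
qed

text \<open>The bound is uniform in \<open>t\<close>. A coordinate in which \<open>z\<close> is at
  least \<open>2 * c\<close> stays at least \<open>c\<close> on the square, which yields a factor
  \<open>exp (- c\<^sup>2 / (2 * t))\<close>. As \<open>exp (- y) \<le> 1 / y\<close>, this is at
  most \<open>2 * t / c\<^sup>2\<close> and cancels the \<open>1 / t\<close> from the two
  densities.\<close>

lemma prob_near_le:
  assumes t: "0 < t" and r: "0 < r" "r \<le> c" and c: "2 * c \<le> \<bar>fst z\<bar> \<or> 2 * c \<le> \<bar>snd z\<bar>"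
  shows "prob (near r z t) \<le> 4 * r\<^sup>2 / (pi * c\<^sup>2)"
proof -
  let ?u = "2 * r / sqrt (2 * pi * t)" and ?E = "exp (- c\<^sup>2 / (2 * t))"
  let ?p = "prob {\<omega> \<in> space M. \<bar>X t \<omega> - X 0 \<omega> - fst z\<bar> < r}"
  let ?q = "prob {\<omega> \<in> space M. \<bar>Y t \<omega> - Y 0 \<omega> - snd z\<bar> < r}"
  have c0: "0 < c" using r by linarith
  note d = increment_distributed[of 0 t, simplified, OF t]
  have le: "?p \<le> ?u" "?q \<le> ?u"
    using normal_prob_interval_le[OF d(1) t, of r 0 "fst z"]
      normal_prob_interval_le[OF d(2) t, of r 0 "snd z"] r by auto
  have le': "?p \<le> ?u * ?E" if "2 * c \<le> \<bar>fst z\<bar>"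
    by (rule normal_prob_interval_le[OF d(1) t]) (use that r in auto)
  have le'': "?q \<le> ?u * ?E" if "2 * c \<le> \<bar>snd z\<bar>"
    by (rule normal_prob_interval_le[OF d(2) t]) (use that r in auto)
  have "prob (near r z t) = ?p * ?q"
    using prob_planar_increment[of 0 t "{fst z - r<..<fst z + r}" "{snd z - r<..<snd z + r}"] t
    by (simp add: near_def abs_less_iff conj_commute algebra_simps)
  also have "\<dots> \<le> ?u * (?u * ?E)"
    using c
  proof
    assume "2 * c \<le> \<bar>fst z\<bar>"
    then have "?p * ?q \<le> ?u * ?E * ?u" using le le' t r by (intro mult_mono) auto
    then show ?thesis by (simp add: ac_simps)
  next
    assume "2 * c \<le> \<bar>snd z\<bar>"
    then show ?thesis using le le'' t r by (intro mult_mono) auto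
  qed
  also have "\<dots> = 4 * r\<^sup>2 / (2 * pi * t) * ?E"
    using t by (simp add: power2_eq_square)
  also have "\<dots> \<le> 4 * r\<^sup>2 / (2 * pi * t) * (2 * t / c\<^sup>2)"
  proof (intro mult_left_mono)
    have "c\<^sup>2 / (2 * t) \<le> exp (c\<^sup>2 / (2 * t))"
      using exp_ge_add_one_self[of "c\<^sup>2 / (2 * t)"] by linarith
    then have "inverse (exp (c\<^sup>2 / (2 * t))) \<le> inverse (c\<^sup>2 / (2 * t))"
      using c0 t by (intro le_imp_inverse_le) auto
    then show "?E \<le> 2 * t / c\<^sup>2" by (simp add: exp_minus inverse_eq_divide)
  qed (use t in auto)
  also have "\<dots> = 4 * r\<^sup>2 / (pi * c\<^sup>2)" using t by simp
  finally show ?thesis .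
qed

text \<open>Compares the expected number of grid times spent in the doubled square with the number of
  those times that follow the first entrance into the square itself.\<close>

lemma prob_grid_hit_le:
  assumes h: "0 < h" and r: "0 < r" "2 * r \<le> c" and c: "2 * c \<le> \<bar>fst z\<bar> \<or> 2 * c \<le> \<bar>snd z\<bar>"
    and k0: "0 < k0" "r\<^sup>2 \<le> real k0 * h"
  shows "prob (\<Union>i\<le>N. near r z (real i * h)) * (\<Sum>k = k0..<K. 1 / (real k * h)) \<le> real (N + K) * (32 / c\<^sup>2)"
proof -
  define F where "F i = first_near r z h i" for i
  define V where "V j = near (2 * r) z (real j * h)" for j
  define Q where "Q = (\<Sum>k = k0..<K. r\<^sup>2 / (2 * pi * (real k * h)))"
  have Fs[measurable]: "F i \<in> events" for i using h by (simp add: F_def sets_first_near)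
  have Vs[measurable]: "V j \<in> events" for j using h by (simp add: V_def sets_near)
  have disj: "disjoint_family F"
    unfolding disjoint_family_on_def
  proof (intro ballI impI)
    fix i j :: nat assume "i \<noteq> j"
    then show "F i \<inter> F j = {}" unfolding F_def first_near_def
      by (cases i j rule: linorder_cases) auto
  qed
  have UN: "(\<Union>i\<le>N. near r z (real i * h)) = (\<Union>i\<le>N. F i)"
  proof (intro equalityI subsetI)
    fix \<omega> assume "\<omega> \<in> (\<Union>i\<le>N. near r z (real i * h))"
    then obtain i where i: "i \<le> N" "\<omega> \<in> near r z (real i * h)" by auto
    define l where "l = (LEAST l. \<omega> \<in> near r z (real l * h))"
    have "\<omega> \<in> near r z (real l * h)" "l \<le> i"
      unfolding l_def using i(2) by (rule LeastI, rule Least_le)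
    moreover have "\<omega> \<notin> near r z (real k * h)" if "k < l" for k
      using that unfolding l_def by (rule not_less_Least)
    ultimately show "\<omega> \<in> (\<Union>i\<le>N. F i)" using i(1) unfolding F_def first_near_def
      by (intro UN_I[of l]) auto
  qed (auto simp: F_def first_near_def)
  have step: "prob (F i) * Q \<le> (\<Sum>j = 1..<N + K. prob (F i \<inter> V j))" if i: "i \<le> N" for i
  proof -
    have "prob (F i) * Q = (\<Sum>k = k0..<K. prob (F i) * (r\<^sup>2 / (2 * pi * (real k * h))))"
      by (simp add: Q_def sum_distrib_left)
    also have "\<dots> \<le> (\<Sum>k = k0..<K. prob (F i \<inter> V (i + k)))"
    proof (rule sum_mono)
      fix k assume k: "k \<in> {k0..<K}"
      let ?s = "real i * h" and ?t = "real (i + k) * h"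
      have ts: "?t - ?s = real k * h" by (simp add: algebra_simps)
      have "real k0 * h \<le> real k * h" using k h by (intro mult_right_mono) auto
      then have "r\<^sup>2 \<le> ?t - ?s" using k0 ts by linarith
      moreover have "?s < ?t" using k k0 h by auto
      ultimately have "r\<^sup>2 / (2 * pi * (?t - ?s)) \<le> prob (moves_less r ?s ?t)"
        using h r by (intro prob_moves_less_ge) auto
      then have "prob (F i) * (r\<^sup>2 / (2 * pi * (real k * h))) \<le> prob (F i) * prob (moves_less r ?s ?t)"
        unfolding ts by (intro mult_left_mono) auto
      also have "\<dots> = prob (F i \<inter> moves_less r ?s ?t)"
        unfolding F_def using k k0 by (intro prob_first_near_moves_less[symmetric] h) auto
      \<comment> \<open>Entering the square and then moving by less than \<open>r\<close> in each
        coordinate leads into the doubled square.\<close>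
      also have "\<dots> \<le> prob (F i \<inter> V (i + k))"
      proof (rule finite_measure_mono)
        show "F i \<inter> moves_less r ?s ?t \<subseteq> F i \<inter> V (i + k)"
          unfolding F_def V_def first_near_def near_def moves_less_def by auto
      qed measurable
      finally show "prob (F i) * (r\<^sup>2 / (2 * pi * (real k * h))) \<le> prob (F i \<inter> V (i + k))" .
    qed
    \<comment> \<open>Reindexed by the absolute time \<open>j = i + k\<close>; since
      \<open>0 < k0\<close> and \<open>i \<le> N\<close>, all these \<open>j\<close> lie in
      \<open>{1..<N + K}\<close>.\<close>
    also have "\<dots> = (\<Sum>j = k0 + i..<K + i. prob (F i \<inter> V j))"
      by (subst sum.shift_bounds_nat_ivl) (simp add: add.commute)
    also have "\<dots> \<le> (\<Sum>j = 1..<N + K. prob (F i \<inter> V j))"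
      using i k0 by (intro sum_mono2) auto
    finally show ?thesis .
  qed
  have "prob (\<Union>i\<le>N. F i) * Q = (\<Sum>i\<le>N. prob (F i) * Q)"
    using disj by (subst finite_measure_finite_Union)
      (auto simp: sum_distrib_right intro: disjoint_family_on_mono)
  also have "\<dots> \<le> (\<Sum>i\<le>N. \<Sum>j = 1..<N + K. prob (F i \<inter> V j))" by (intro sum_mono step) auto
  also have "\<dots> = (\<Sum>j = 1..<N + K. \<Sum>i\<le>N. prob (F i \<inter> V j))" by (rule sum.swap)
  also have "\<dots> \<le> (\<Sum>j = 1..<N + K. 4 * (2 * r)\<^sup>2 / (pi * c\<^sup>2))"
  proof (rule sum_mono)
    fix j assume j: "j \<in> {1..<N + K}"
    \<comment> \<open>For a fixed \<open>j\<close> the first-entrance events are disjoint, so their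
      parts in \<open>V j\<close> have total probability at most that of \<open>V j\<close>.\<close>
    have "(\<Sum>i\<le>N. prob (F i \<inter> V j)) = prob (\<Union>i\<le>N. F i \<inter> V j)"
      using disj by (intro finite_measure_finite_Union[symmetric])
        (auto simp: disjoint_family_on_def)
    also have "\<dots> \<le> prob (V j)" by (intro finite_measure_mono) auto
    also have "\<dots> \<le> 4 * (2 * r)\<^sup>2 / (pi * c\<^sup>2)"
      unfolding V_def using j h r c by (intro prob_near_le) auto
    finally show "(\<Sum>i\<le>N. prob (F i \<inter> V j)) \<le> 4 * (2 * r)\<^sup>2 / (pi * c\<^sup>2)" .
  qed
  also have "\<dots> \<le> real (N + K) * (4 * (2 * r)\<^sup>2 / (pi * c\<^sup>2))"
    by (simp, intro divide_right_mono mult_right_mono) auto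
  finally have "prob (\<Union>i\<le>N. F i) * Q \<le> real (N + K) * (4 * (2 * r)\<^sup>2 / (pi * c\<^sup>2))" .
  also have "Q = r\<^sup>2 / (2 * pi) * (\<Sum>k = k0..<K. 1 / (real k * h))"
    by (simp add: Q_def sum_distrib_left)
  \<comment> \<open>Both sides carry the factor \<open>r\<^sup>2 / (2 * pi)\<close>. Cancelling it
    leaves the harmonic sum as the only dependence on the scale.\<close>
  also have "real (N + K) * (4 * (2 * r)\<^sup>2 / (pi * c\<^sup>2)) = r\<^sup>2 / (2 * pi) * (real (N + K) * (32 / c\<^sup>2))"
    using r by (simp add: power_mult_distrib field_simps)
  finally have "r\<^sup>2 / (2 * pi) * (prob (\<Union>i\<le>N. F i) * (\<Sum>k = k0..<K. 1 / (real k * h)))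
      \<le> r\<^sup>2 / (2 * pi) * (real (N + K) * (32 / c\<^sup>2))" by (simp only: ac_simps)
  then show ?thesis unfolding UN using r by (subst (asm) mult_le_cancel_left_pos) auto
qed

end

section \<open>Dyadic grids and the limit of vanishing mesh\<close>

text \<open>Each dyadic block contributes at least \<open>1 / 2\<close>: it has
  \<open>2 ^ (a + b)\<close> terms, none below \<open>1 / 2 ^ (a + b + 1)\<close>.\<close>

lemma harmonic_dyadic_ge: "real b / 2 \<le> (\<Sum>k = 2 ^ a..<2 ^ (a + b). 1 / real k)"
proof (induction b)
  case (Suc b)
  have "(\<Sum>k = 2 ^ (a + b)..<2 ^ Suc (a + b). 1 / real k) \<ge> (\<Sum>k = (2::nat) ^ (a + b)..<2 ^ Suc (a + b). 1 / 2 ^ Suc (a + b))"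
  proof (rule sum_mono)
    fix k :: nat assume "k \<in> {2 ^ (a + b)..<2 ^ Suc (a + b)}"
    then have k: "0 < k" "k \<le> 2 ^ Suc (a + b)" by (auto intro: less_le_trans[of 0 "2 ^ (a + b)"])
    then have "real k \<le> real (2 ^ Suc (a + b))" by (simp only: of_nat_le_iff)
    then show "1 / 2 ^ Suc (a + b) \<le> 1 / real k" using k(1) by (intro divide_left_mono) auto
  qed
  then have "1 / 2 \<le> (\<Sum>k = 2 ^ (a + b)..<2 ^ Suc (a + b). 1 / real k)" by simp
  moreover have "(\<Sum>k = 2 ^ a..<2 ^ (a + Suc b). 1 / real k)
      = (\<Sum>k = 2 ^ a..<2 ^ (a + b). 1 / real k) + (\<Sum>k = 2 ^ (a + b)..<2 ^ Suc (a + b). 1 / real k)"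
    by (subst sum.atLeastLessThan_concat) (auto intro: power_increasing)
  ultimately show ?case using Suc by simp
qed simp

context planar_brownian_motion
begin

definition dyadic_near :: "nat \<Rightarrow> real \<Rightarrow> real \<times> real \<Rightarrow> nat \<Rightarrow> 'a set" where
  "dyadic_near T r z m = {\<omega> \<in> space M. \<exists>i\<le>T * 2 ^ m.
     \<bar>X (real i * (1 / 2 ^ m)) \<omega> - fst z\<bar> < r \<and> \<bar>Y (real i * (1 / 2 ^ m)) \<omega> - snd z\<bar> < r}"

lemma sets_dyadic_near[measurable]: "dyadic_near T r z m \<in> events"
proof -
  have "X (real i * (1 / 2 ^ m)) \<in> borel_measurable M" "Y (real i * (1 / 2 ^ m)) \<in> borel_measurable M" for i
    by (intro measurable_coordinates; simp)+
  note this[measurable]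
  have "dyadic_near T r z m = (\<Union>i\<le>T * 2 ^ m. {\<omega> \<in> space M.
      \<bar>X (real i * (1 / 2 ^ m)) \<omega> - fst z\<bar> < r \<and> \<bar>Y (real i * (1 / 2 ^ m)) \<omega> - snd z\<bar> < r})"
    unfolding dyadic_near_def by auto
  also have "\<dots> \<in> events" by measurable
  finally show ?thesis .
qed

text \<open>With mesh \<open>2 ^ - m\<close>, the choice \<open>k0 = 2 ^ (m - 2 * L)\<close> makes
  \<open>k0 * h\<close> equal to \<open>r\<^sup>2\<close>, and with \<open>K = 2 ^ m\<close> the
  harmonic sum covers \<open>2 * L\<close> dyadic blocks. The factor \<open>2 ^ m\<close> from the
  mesh then cancels against \<open>N + K = (T + 1) * 2 ^ m\<close>.\<close>

lemma prob_dyadic_near_le: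
  assumes L: "0 < L" "2 * (1 / 2) ^ L \<le> c" and c: "2 * c \<le> \<bar>fst z\<bar> \<or> 2 * c \<le> \<bar>snd z\<bar>"
    and m: "2 * L \<le> m"
  shows "prob (dyadic_near T ((1 / 2) ^ L) z m) \<le> 32 * real (Suc T) / (c\<^sup>2 * real L)"
proof -
  let ?r = "(1 / 2 :: real) ^ L" and ?h = "1 / 2 ^ m :: real"
  let ?N = "T * 2 ^ m" and ?k0 = "2 ^ (m - 2 * L)"
  have c0: "0 < c" using L(2) zero_less_power[of "1 / 2 :: real" L] by linarith
  \<comment> \<open>\<open>dyadic_near\<close> speaks of positions and \<open>near\<close> of
    displacements; they agree almost surely.\<close>
  have "AE \<omega> in M. X 0 \<omega> = 0 \<and> Y 0 \<omega> = 0"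
    using X Y by (auto simp: standard_brownian_motion_def)
  then have "prob (dyadic_near T ?r z m) = prob (\<Union>i\<le>?N. near ?r z (real i * ?h))"
  proof (intro finite_measure_eq_AE)
    show "AE \<omega> in M. (\<omega> \<in> dyadic_near T ?r z m) = (\<omega> \<in> (\<Union>i\<le>?N. near ?r z (real i * ?h)))"
      if "AE \<omega> in M. X 0 \<omega> = 0 \<and> Y 0 \<omega> = 0"
      using that by eventually_elim (auto simp: dyadic_near_def near_def)
    show "(\<Union>i\<le>?N. near ?r z (real i * ?h)) \<in> events" by (intro sets.finite_UN sets_near) auto
  qed (rule sets_dyadic_near)
  moreover have "prob (\<Union>i\<le>?N. near ?r z (real i * ?h)) * (\<Sum>k = ?k0..<2 ^ m. 1 / (real k * ?h))
      \<le> real (?N + 2 ^ m) * (32 / c\<^sup>2)"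
  proof (rule prob_grid_hit_le)
    obtain d where "m = 2 * L + d" using m le_Suc_ex by blast
    then have "real ?k0 * ?h = ?r\<^sup>2"
      by (simp add: power_add power_one_over power_mult[symmetric] mult.commute)
    then show "?r\<^sup>2 \<le> real ?k0 * ?h" by simp
  qed (use L c in auto)
  moreover have "2 ^ m * real L \<le> (\<Sum>k = ?k0..<2 ^ m. 1 / (real k * ?h))"
  proof -
    have "real L = real (2 * L) / 2" by simp
    also have "\<dots> \<le> (\<Sum>k = ?k0..<2 ^ m. 1 / real k)"
      using harmonic_dyadic_ge[of "2 * L" "m - 2 * L"] m by simp
    finally have "2 ^ m * real L \<le> 2 ^ m * (\<Sum>k = ?k0..<2 ^ m. 1 / real k)"
      by (intro mult_left_mono) auto
    then show ?thesis by (simp add: sum_distrib_left)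
  qed
  ultimately have "prob (dyadic_near T ?r z m) * (2 ^ m * real L) \<le> real (?N + 2 ^ m) * (32 / c\<^sup>2)"
    by (smt (verit) mult_left_mono measure_nonneg)
  also have "\<dots> = 2 ^ m * (real (Suc T) * (32 / c\<^sup>2))"
    by (simp add: algebra_simps add_divide_distrib)
  finally have "2 ^ m * (prob (dyadic_near T ?r z m) * real L) \<le> 2 ^ m * (real (Suc T) * (32 / c\<^sup>2))"
    by (simp only: mult.left_commute)
  then have "prob (dyadic_near T ?r z m) * real L \<le> real (Suc T) * (32 / c\<^sup>2)"
    by (subst (asm) mult_le_cancel_left_pos) auto
  then show ?thesis using L(1) c0 by (simp add: field_simps)
qed

text \<open>The grids are nested: index \<open>i\<close> becomes \<open>2 * i\<close> at the next
  level.\<close>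

lemma incseq_dyadic_near: "incseq (dyadic_near T r z)"
proof (rule incseq_SucI, rule subsetI)
  fix m \<omega> assume "\<omega> \<in> dyadic_near T r z m"
  then obtain i where "\<omega> \<in> space M" "i \<le> T * 2 ^ m"
    "\<bar>X (real i * (1 / 2 ^ m)) \<omega> - fst z\<bar> < r" "\<bar>Y (real i * (1 / 2 ^ m)) \<omega> - snd z\<bar> < r"
    by (auto simp: dyadic_near_def)
  then show "\<omega> \<in> dyadic_near T r z (Suc m)"
    unfolding dyadic_near_def by (auto intro!: exI[of _ "2 * i"])
qed

text \<open>The bound does not involve \<open>m\<close>, so it survives the limit by continuity from
  below.\<close>

lemma prob_UN_dyadic_near_le:
  assumes L: "0 < L" "2 * (1 / 2) ^ L \<le> c" and c: "2 * c \<le> \<bar>fst z\<bar> \<or> 2 * c \<le> \<bar>snd z\<bar>"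
  shows "prob (\<Union>m. dyadic_near T ((1 / 2) ^ L) z m) \<le> 32 * real (Suc T) / (c\<^sup>2 * real L)"
proof (rule LIMSEQ_le_const2)
  show "(\<lambda>m. prob (dyadic_near T ((1 / 2) ^ L) z m)) \<longlonglongrightarrow> prob (\<Union>m. dyadic_near T ((1 / 2) ^ L) z m)"
    by (intro finite_Lim_measure_incseq incseq_dyadic_near) auto
  show "\<exists>N. \<forall>m\<ge>N. prob (dyadic_near T ((1 / 2) ^ L) z m) \<le> 32 * real (Suc T) / (c\<^sup>2 * real L)"
    using prob_dyadic_near_le[OF assms] by blast
qed

end

text \<open>Rounding \<open>s\<close> down to multiples of \<open>1 / 2 ^ m\<close> gives grid times
  in \<open>{0..T}\<close> that converge to \<open>s\<close>, and the strict inequality persists for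
  large \<open>m\<close>.\<close>

lemma continuous_dyadic_approach:
  fixes f :: "real \<Rightarrow> real \<times> real"
  assumes f: "continuous_on {0..} f" and s: "0 \<le> s" "s \<le> real T" and near: "dist (f s) z < r"
  shows "\<exists>m. \<exists>i\<le>T * 2 ^ m. \<bar>fst (f (real i * (1 / 2 ^ m))) - fst z\<bar> < r \<and>
    \<bar>snd (f (real i * (1 / 2 ^ m))) - snd z\<bar> < r"
proof -
  define i where "i m = nat \<lfloor>s * 2 ^ m\<rfloor>" for m :: nat
  define d where "d m = real (i m) * (1 / 2 ^ m)" for m
  have i: "real (i m) \<le> s * 2 ^ m" "s * 2 ^ m < real (i m) + 1" for m
    using s(1) by (simp_all add: i_def)
  have d: "d m \<le> s" "s - (1 / 2) ^ m \<le> d m" for m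
    using i[of m] by (simp_all add: d_def power_one_over pos_divide_le_eq pos_le_divide_eq
        diff_le_eq flip: add_divide_distrib)
  have iT: "i m \<le> T * 2 ^ m" for m
  proof -
    have "s * 2 ^ m \<le> real T * 2 ^ m" using s(2) by (intro mult_right_mono) auto
    with i(1)[of m] have "real (i m) \<le> real T * 2 ^ m" by linarith
    then have "real (i m) \<le> real (T * 2 ^ m)" by simp
    then show ?thesis by (simp only: of_nat_le_iff)
  qed
  have "d \<longlonglongrightarrow> s"
  proof (rule tendsto_sandwich)
    have "(\<lambda>m. s - (1 / 2) ^ m) \<longlonglongrightarrow> s - 0" by (intro tendsto_intros LIMSEQ_power_zero) simp
    then show "(\<lambda>m. s - (1 / 2) ^ m) \<longlonglongrightarrow> s" by simp
  qed (use d in auto)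
  then have "(\<lambda>m. f (d m)) \<longlonglongrightarrow> f s"
    by (rule continuous_on_tendsto_compose[OF f]) (use s in \<open>simp_all add: d_def\<close>)
  then have "(\<lambda>m. dist (f (d m)) z) \<longlonglongrightarrow> dist (f s) z" by (intro tendsto_intros)
  then have "\<forall>\<^sub>F m in sequentially. dist (f (d m)) z < r" using near by (rule order_tendstoD)
  then obtain m where "dist (f (d m)) z < r" by (auto simp: eventually_sequentially)
  then have "\<bar>fst (f (d m)) - fst z\<bar> < r" "\<bar>snd (f (d m)) - snd z\<bar> < r"
    using dist_fst_le[of "f (d m)" z] dist_snd_le[of "f (d m)" z] by (auto simp: dist_real_def)
  then show ?thesis using iT[of m] unfolding d_def by blast
qed

section \<open>The Martin-Loef test relative to a name\<close>

lemma planar_brownian_motion_wiener: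
  "planar_wiener_measure W \<Longrightarrow> planar_brownian_motion W (\<lambda>t B. fst (B t)) (\<lambda>t B. snd (B t))"
  by (auto simp: planar_wiener_measure_def standard_brownian_motion_def planar_brownian_motion_def
      planar_brownian_motion_axioms_def)

text \<open>A path in the test set comes within \<open>(1 / 2) ^ L\<close> of \<open>z\<close> by
  time \<open>T + 1\<close>, hence lies in the square at some dyadic time. The horizon
  \<open>T + 1\<close> accounts for the factor \<open>T + 2\<close>.\<close>

lemma measure_approach_test_le:
  assumes W: "planar_wiener_measure W" and p: "is_name p z"
    and L: "0 < L" "2 * (1 / 2) ^ L \<le> c" and c: "2 * c \<le> \<bar>fst z\<bar> \<or> 2 * c \<le> \<bar>snd z\<bar>"
  shows "measure W (approach_test p (Suc T) (L + T + 2)) \<le> 32 * real (T + 2) / (c\<^sup>2 * real L)"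
proof -
  interpret planar_brownian_motion W "\<lambda>t B. fst (B t)" "\<lambda>t B. snd (B t)"
    by (rule planar_brownian_motion_wiener[OF W])
  have sp: "space W = path_space" using W by (simp add: planar_wiener_measure_def)
  have "approach_test p (Suc T) (L + T + 2) \<subseteq> (\<Union>m. dyadic_near (Suc T) ((1 / 2) ^ L) z m)"
  proof
    fix B assume "B \<in> approach_test p (Suc T) (L + T + 2)"
    note B = approach_test_sound[OF this p]
    then obtain s where s: "0 \<le> s" "s \<le> real (Suc T)" "dist (B s) z < (1 / 2) ^ L" by blast
    have "continuous_on {0..} B" using B(1) by (simp add: path_space_def)
    from continuous_dyadic_approach[OF this s] B(1)
    show "B \<in> (\<Union>m. dyadic_near (Suc T) ((1 / 2) ^ L) z m)"
      by (auto simp: dyadic_near_def sp)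
  qed
  then have "measure W (approach_test p (Suc T) (L + T + 2))
      \<le> measure W (\<Union>m. dyadic_near (Suc T) ((1 / 2) ^ L) z m)"
    by (intro finite_measure_mono) auto
  also have "\<dots> \<le> 32 * real (Suc (Suc T)) / (c\<^sup>2 * real L)"
    by (rule prob_UN_dyadic_near_le[OF L c])
  finally show ?thesis by simp
qed

lemma uniformly_effectively_open_approach_test:
  "uniformly_effectively_open p (\<lambda>n. approach_test p T (K * 2 ^ n + a))"
proof -
  have comp: "total_computable p 1 (\<lambda>xs. prod_encode (2, 2 ^ (K * 2 ^ hd xs + a)))"
    "total_computable p 1 (\<lambda>xs. p (K * 2 ^ hd xs + a + 4))"
    unfolding One_nat_def
    by (intro total_computable_prod_encode total_computable_power2 total_computable_add
        total_computable_mult total_computable_oracle total_computable_const total_computable_hd)+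
  show ?thesis
    unfolding uniformly_effectively_open_def
  proof (intro exI conjI allI)
    show "ce_relative p {prod_encode (n, prod_encode (prod_encode (m, list_encode cs),
        prod_encode (2, 2 ^ (K * 2 ^ n + a)))) | n m cs.
        \<exists>j<length cs. j \<le> Suc m * T \<and> cs ! j = p (K * 2 ^ n + a + 4)}"
      by (rule ce_relative_polygon_test[OF comp])
  qed (auto simp: approach_test_def prod_encode_eq)
qed

theorem theorem5p3:
  fixes W :: "planar_path measure" and B :: planar_path
  assumes "planar_wiener_measure W"
    and "ml_random W B"
    and "B 0 = (0, 0)"
  shows "\<forall>t>0. B t \<noteq> (0, 0) \<longrightarrow> \<not> ml_random_relative_to_point W B (B t)"
proof (intro allI impI notI)
  fix t :: real assume t: "0 < t" and nz: "B t \<noteq> (0, 0)" and rel: "ml_random_relative_to_point W B (B t)"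
  obtain p where p: "is_name p (B t)" and rand: "ml_random_relative p W B"
    using rel by (auto simp: ml_random_relative_to_point_def)
  define z where "z = B t"
  define T where "T = nat \<lceil>t\<rceil>"
  \<comment> \<open>Half of the larger coordinate, positive because \<open>z\<close> is not the
    origin.\<close>
  define c where "c = max \<bar>fst z\<bar> \<bar>snd z\<bar> / 2"
  have tT: "t \<le> real (Suc T)" using t unfolding T_def by linarith
  have c: "0 < c" "2 * c \<le> \<bar>fst z\<bar> \<or> 2 * c \<le> \<bar>snd z\<bar>"
    using nz by (auto simp: c_def z_def max_def prod_eq_iff)
  \<comment> \<open>\<open>K1\<close> makes the squares small compared with \<open>c\<close>;
    \<open>K2\<close> below absorbs the constant of the measure bound.\<close>
  obtain K1 where K1: "(1 / 2 :: real) ^ K1 < c / 2"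
    using real_arch_pow_inv[of "c / 2" "1 / 2"] c by auto
  obtain K2 where K2: "32 * real (T + 2) / c\<^sup>2 \<le> real K2" using real_arch_simple by blast
  define K where "K = Suc (max K1 K2)"
  \<comment> \<open>\<open>K\<close> and \<open>T\<close> depend on the point and the time, but they
    are single numbers and enter the test as constants of the program; only approximations to
    \<open>z\<close> come from the oracle.\<close>
  define U where "U n = approach_test p (Suc T) (K * 2 ^ n + (T + 2))" for n
  have "measure W (U n) \<le> (1 / 2) ^ n" for n
  proof -
    let ?L = "K * 2 ^ n"
    have "K \<le> ?L" by simp
    then have "K1 \<le> ?L" unfolding K_def by linarith
    then have "(1 / 2 :: real) ^ ?L \<le> (1 / 2) ^ K1" by (intro power_decreasing) auto
    then have "2 * (1 / 2 :: real) ^ ?L \<le> c" using K1 by linarith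
    moreover have "0 < ?L" by (simp add: K_def)
    ultimately have "measure W (U n) \<le> 32 * real (T + 2) / (c\<^sup>2 * real ?L)"
      using measure_approach_test_le[OF assms(1) p, of ?L c T] c(2)
      unfolding U_def z_def add.assoc by blast
    also have "\<dots> = 32 * real (T + 2) / c\<^sup>2 / real K * (1 / 2) ^ n"
      by (simp add: power_one_over)
    also have "\<dots> \<le> 1 * (1 / 2) ^ n"
    proof (rule mult_right_mono)
      have "32 * real (T + 2) / c\<^sup>2 \<le> real K" using K2 by (simp add: K_def)
      moreover have "0 < real K" by (simp add: K_def)
      ultimately show "32 * real (T + 2) / c\<^sup>2 / real K \<le> 1" by (simp only: pos_divide_le_eq mult_1)
    qed simp
    finally show ?thesis by simp
  qed
  then have "ml_test p W U"
    unfolding ml_test_def U_def using uniformly_effectively_open_approach_test by blast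
  moreover have "B \<in> path_space" using rand by (simp add: ml_random_relative_def)
  then have "B \<in> (\<Inter>n. U n)"
    unfolding U_def using t tT p by (intro INT_I approach_test_captures) auto
  ultimately show False using rand by (auto simp: ml_random_relative_def)
qed

end
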